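(* Let $P$ be Thompson's quandle. The canonical map $P\to\mathrm{Gr}(P)$, $x\mapsto g_x$, is injective; that is, under the isomorphism $\mathrm{Gr}(P)\cong F$, it embeds Thompson's quandle $P$ into Thompson's group $F$.
   Context: A quandle is a set $Q$ with a binary operation $\rhd$ such that for every $x\in Q$ the left multiplication $y\mapsto x\rhd y$ is bijective, $x\rhd(y\rhd z)=(x\rhd y)\rhd(x\rhd z)$ for all $x,y,z$, and $x\rhd x=x$ for all $x$. Thompson's quandle $P$ is the quandle with generators $p_0,p_1,p_2,\dots$ and relations $p_j\rhd p_k=p_{k+1}$ for all $0\leqslant j<k$. The enveloping group $\mathrm{Gr}(Q)$ of a quandle $Q$ is the group with generating set $\{g_x\mid x\in Q\}$ and relations $g_{x\rhd y}=g_xg_y(g_x)^{-1}$ for all $x,y\in Q$. The canonical map $Q\to\mathrm{Gr}(Q)$ sends $x$ to $g_x$; it is a morphism of quandles when $\mathrm{Gr}(Q)$ carries the conjugation quandle structure $g\rhd h=ghg^{-1}$. Thompson's group $F$ is the group of piecewise linear orientation-preserving homeomorphisms of $[0,1]$ with finitely many breakpoints, all at dyadic rationals, and all slopes integer powers of $2$; by standard facts, it has the presentation $\langle x_0,x_1,x_2,\dots\mid x_jx_kx_j^{-1}=x_{k+1}\text{ for all }j<k\rangle$, and the isomorphism $\mathrm{Gr}(P)\cong F$ sends $g_{p_j}$ to $x_j$. *)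

theory Defs
  imports "HOL-Analysis.Analysis" "HOL-Algebra.Bij"
begin

section \<open>Quandles\<close>

record 'q quandle_struct = "'q partial_object" +
  qop :: "'q \<Rightarrow> 'q \<Rightarrow> 'q"

locale quandle =
  fixes Q :: "('q, 'm) quandle_struct_scheme"
  assumes left_mult_bij: "x \<in> carrier Q \<Longrightarrow> bij_betw (qop Q x) (carrier Q) (carrier Q)"
    and left_distrib: "\<lbrakk>x \<in> carrier Q; y \<in> carrier Q; z \<in> carrier Q\<rbrakk> \<Longrightarrow>
      qop Q x (qop Q y z) = qop Q (qop Q x y) (qop Q x z)"
    and idem: "x \<in> carrier Q \<Longrightarrow> qop Q x x = x"

definition quandle_hom ::
  "('q, 'm) quandle_struct_scheme \<Rightarrow> ('r, 'n) quandle_struct_scheme \<Rightarrow> ('q \<Rightarrow> 'r) set" where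
  "quandle_hom Q R = {f. f \<in> carrier Q \<rightarrow> carrier R \<and>
     (\<forall>x\<in>carrier Q. \<forall>y\<in>carrier Q. f (qop Q x y) = qop R (f x) (f y))}"

definition quandle_embedding ::
  "('q, 'm) quandle_struct_scheme \<Rightarrow> ('r, 'n) quandle_struct_scheme \<Rightarrow> ('q \<Rightarrow> 'r) \<Rightarrow> bool" where
  "quandle_embedding Q R f \<longleftrightarrow> f \<in> quandle_hom Q R \<and> inj_on f (carrier Q)"

definition Conj :: "('g, 'm) monoid_scheme \<Rightarrow> 'g quandle_struct" where
  "Conj G = \<lparr>carrier = carrier G, qop = (\<lambda>g h. g \<otimes>\<^bsub>G\<^esub> h \<otimes>\<^bsub>G\<^esub> inv\<^bsub>G\<^esub> g)\<rparr>"

lemma (in group) quandle_Conj: "quandle (Conj G)"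
proof -
  have cancel: "x \<otimes> (inv x \<otimes> y) = y" "inv x \<otimes> (x \<otimes> y) = y"
    if "x \<in> carrier G" "y \<in> carrier G" for x y
    using that by (simp_all flip: m_assoc)
  show ?thesis
  proof
    fix x assume x: "x \<in> carrier (Conj G)"
    show "bij_betw (qop (Conj G) x) (carrier (Conj G)) (carrier (Conj G))"
      by (rule bij_betw_byWitness[where f' = "\<lambda>y. inv x \<otimes> y \<otimes> x"])
        (use x in \<open>auto simp: Conj_def m_assoc cancel\<close>)
  next
    fix x y z assume "x \<in> carrier (Conj G)" "y \<in> carrier (Conj G)" "z \<in> carrier (Conj G)"
    then show "qop (Conj G) x (qop (Conj G) y z) = qop (Conj G) (qop (Conj G) x y) (qop (Conj G) x z)"
      by (simp add: Conj_def m_assoc inv_mult_group cancel)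
  next
    fix x assume "x \<in> carrier (Conj G)"
    then show "qop (Conj G) x x = x"
      by (simp add: Conj_def m_assoc)
  qed
qed


section \<open>Presentations of quandles\<close>

text \<open>
  Since left multiplications in a quandle are required to be bijective, the quandle generated by
  a set consists of the values of terms in both the operation and its left inverse
  (the term \<open>QInv s t\<close> denotes the preimage of \<open>t\<close> under left multiplication by \<open>s\<close>).
\<close>

datatype 'a qterm = QGen 'a | QOp "'a qterm" "'a qterm" | QInv "'a qterm" "'a qterm"

inductive qeq :: "('a qterm \<times> 'a qterm) set \<Rightarrow> 'a qterm \<Rightarrow> 'a qterm \<Rightarrow> bool"
  for R :: "('a qterm \<times> 'a qterm) set" where
  qeq_rel: "(s, t) \<in> R \<Longrightarrow> qeq R s t"
| qeq_refl: "qeq R s s"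
| qeq_sym: "qeq R s t \<Longrightarrow> qeq R t s"
| qeq_trans: "qeq R s t \<Longrightarrow> qeq R t u \<Longrightarrow> qeq R s u"
| qeq_QOp: "qeq R s s' \<Longrightarrow> qeq R t t' \<Longrightarrow> qeq R (QOp s t) (QOp s' t')"
| qeq_QInv: "qeq R s s' \<Longrightarrow> qeq R t t' \<Longrightarrow> qeq R (QInv s t) (QInv s' t')"
| qeq_QInv_QOp: "qeq R (QInv s (QOp s t)) t"
| qeq_QOp_QInv: "qeq R (QOp s (QInv s t)) t"
| qeq_distrib: "qeq R (QOp s (QOp t u)) (QOp (QOp s t) (QOp s u))"
| qeq_idem: "qeq R (QOp s s) s"

definition qclass :: "('a qterm \<times> 'a qterm) set \<Rightarrow> 'a qterm \<Rightarrow> 'a qterm set" where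
  "qclass R s = {t. qeq R s t}"

definition presented_quandle :: "('a qterm \<times> 'a qterm) set \<Rightarrow> 'a qterm set quandle_struct" where
  "presented_quandle R = \<lparr>carrier = range (qclass R),
     qop = (\<lambda>A B. \<Union>s\<in>A. \<Union>t\<in>B. qclass R (QOp s t))\<rparr>"

lemma qclass_eq_iff: "qclass R s = qclass R t \<longleftrightarrow> qeq R s t"
  unfolding qclass_def using qeq_refl[of R t] by (blast dest: qeq_sym intro: qeq_trans)

lemma qop_qclass: "qop (presented_quandle R) (qclass R s) (qclass R t) = qclass R (QOp s t)"
proof -
  have "qclass R (QOp s' t') = qclass R (QOp s t)" if "s' \<in> qclass R s" "t' \<in> qclass R t" for s' t'
    using that unfolding qclass_eq_iff by (simp add: qclass_def qeq_QOp qeq_sym)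
  then have "(\<Union>s'\<in>qclass R s. \<Union>t'\<in>qclass R t. qclass R (QOp s' t')) =
      (\<Union>s'\<in>qclass R s. \<Union>t'\<in>qclass R t. qclass R (QOp s t))"
    by (intro SUP_cong refl)
  moreover have "s \<in> qclass R s" "t \<in> qclass R t"
    by (auto simp: qclass_def qeq_refl)
  ultimately show ?thesis
    by (auto simp: presented_quandle_def)
qed

lemma quandle_presented_quandle: "quandle (presented_quandle R)"
proof
  fix x assume "x \<in> carrier (presented_quandle R)"
  then obtain s where s: "x = qclass R s" by (auto simp: presented_quandle_def)
  have "inj_on (qop (presented_quandle R) x) (carrier (presented_quandle R))"
  proof (rule inj_onI)
    fix y z assume "y \<in> carrier (presented_quandle R)" "z \<in> carrier (presented_quandle R)"
      and eq: "qop (presented_quandle R) x y = qop (presented_quandle R) x z"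
    then obtain t u where tu: "y = qclass R t" "z = qclass R u"
      by (auto simp: presented_quandle_def)
    have "qeq R (QOp s t) (QOp s u)"
      using eq by (simp add: s tu qop_qclass qclass_eq_iff)
    then have "qeq R (QInv s (QOp s t)) (QInv s (QOp s u))"
      by (intro qeq_QInv qeq_refl)
    then show "y = z"
      unfolding tu qclass_eq_iff by (meson qeq_QInv_QOp qeq_sym qeq_trans)
  qed
  moreover have "qop (presented_quandle R) x ` carrier (presented_quandle R) = carrier (presented_quandle R)"
  proof (intro equalityI subsetI)
    fix y assume "y \<in> qop (presented_quandle R) x ` carrier (presented_quandle R)"
    then show "y \<in> carrier (presented_quandle R)"
      unfolding s by (auto simp: presented_quandle_def qop_qclass[unfolded presented_quandle_def, simplified])
  next
    fix y assume "y \<in> carrier (presented_quandle R)"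
    then obtain t where t: "y = qclass R t" by (auto simp: presented_quandle_def)
    have "y = qop (presented_quandle R) x (qclass R (QInv s t))"
      by (simp add: s t qop_qclass qclass_eq_iff qeq_sym[OF qeq_QOp_QInv])
    then show "y \<in> qop (presented_quandle R) x ` carrier (presented_quandle R)"
      by (rule image_eqI) (simp add: presented_quandle_def)
  qed
  ultimately show "bij_betw (qop (presented_quandle R) x)
      (carrier (presented_quandle R)) (carrier (presented_quandle R))"
    unfolding bij_betw_def ..
next
  fix x y z assume "x \<in> carrier (presented_quandle R)" "y \<in> carrier (presented_quandle R)"
    "z \<in> carrier (presented_quandle R)"
  then obtain s t u where "x = qclass R s" "y = qclass R t" "z = qclass R u"
    by (auto simp: presented_quandle_def)
  then show "qop (presented_quandle R) x (qop (presented_quandle R) y z) =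
      qop (presented_quandle R) (qop (presented_quandle R) x y) (qop (presented_quandle R) x z)"
    by (simp add: qop_qclass qclass_eq_iff qeq_distrib)
next
  fix x assume "x \<in> carrier (presented_quandle R)"
  then obtain s where "x = qclass R s" by (auto simp: presented_quandle_def)
  then show "qop (presented_quandle R) x x = x"
    by (simp add: qop_qclass qclass_eq_iff qeq_idem)
qed


section \<open>Presentations of groups\<close>

text \<open>A letter \<open>(x, True)\<close> stands for the generator \<open>x\<close>, and \<open>(x, False)\<close> for its inverse.\<close>

type_synonym 'a gword = "('a \<times> bool) list"

definition gwords :: "'a set \<Rightarrow> 'a gword set" where
  "gwords X = lists (X \<times> UNIV)"

inductive geq :: "'a set \<Rightarrow> ('a gword \<times> 'a gword) set \<Rightarrow> 'a gword \<Rightarrow> 'a gword \<Rightarrow> bool"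
  for X :: "'a set" and R :: "('a gword \<times> 'a gword) set" where
  geq_rel: "(u, v) \<in> R \<Longrightarrow> u \<in> gwords X \<Longrightarrow> v \<in> gwords X \<Longrightarrow> geq X R u v"
| geq_refl: "u \<in> gwords X \<Longrightarrow> geq X R u u"
| geq_sym: "geq X R u v \<Longrightarrow> geq X R v u"
| geq_trans: "geq X R u v \<Longrightarrow> geq X R v w \<Longrightarrow> geq X R u w"
| geq_append: "geq X R u u' \<Longrightarrow> geq X R v v' \<Longrightarrow> geq X R (u @ v) (u' @ v')"
| geq_cancel: "x \<in> X \<Longrightarrow> geq X R [(x, b), (x, \<not> b)] []"

definition gclass :: "'a set \<Rightarrow> ('a gword \<times> 'a gword) set \<Rightarrow> 'a gword \<Rightarrow> 'a gword set" where
  "gclass X R u = {v. geq X R u v}"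

definition presented_group :: "'a set \<Rightarrow> ('a gword \<times> 'a gword) set \<Rightarrow> 'a gword set monoid" where
  "presented_group X R = \<lparr>carrier = gclass X R ` gwords X,
     mult = (\<lambda>A B. \<Union>u\<in>A. \<Union>v\<in>B. gclass X R (u @ v)),
     one = gclass X R []\<rparr>"

lemma geq_gwords: "geq X R u v \<Longrightarrow> u \<in> gwords X \<and> v \<in> gwords X"
  by (induction rule: geq.induct) (auto simp: gwords_def)

lemma gclass_eq_iff:
  "u \<in> gwords X \<Longrightarrow> v \<in> gwords X \<Longrightarrow> gclass X R u = gclass X R v \<longleftrightarrow> geq X R u v"
  unfolding gclass_def using geq_refl[of v X R] by (blast dest: geq_sym intro: geq_trans)

lemma mult_gclass:
  assumes "u \<in> gwords X" "v \<in> gwords X"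
  shows "gclass X R u \<otimes>\<^bsub>presented_group X R\<^esub> gclass X R v = gclass X R (u @ v)"
proof -
  have "gclass X R (u' @ v') = gclass X R (u @ v)"
    if "u' \<in> gclass X R u" "v' \<in> gclass X R v" for u' v'
  proof -
    from that have *: "geq X R (u' @ v') (u @ v)"
      by (simp add: gclass_def geq_append geq_sym)
    from geq_gwords[OF this] show ?thesis
      by (simp add: gclass_eq_iff *)
  qed
  then have "(\<Union>u'\<in>gclass X R u. \<Union>v'\<in>gclass X R v. gclass X R (u' @ v')) =
      (\<Union>u'\<in>gclass X R u. \<Union>v'\<in>gclass X R v. gclass X R (u @ v))"
    by (intro SUP_cong refl)
  moreover have "u \<in> gclass X R u" "v \<in> gclass X R v"
    using assms by (auto simp: gclass_def geq_refl)
  ultimately show ?thesis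
    by (auto simp: presented_group_def)
qed

lemma geq_left_inverse:
  "u \<in> gwords X \<Longrightarrow> geq X R (rev (map (\<lambda>(x, b). (x, \<not> b)) u) @ u) []"
proof (induction u)
  case Nil
  then show ?case by (simp add: geq_refl)
next
  case (Cons a u)
  obtain x b where a: "a = (x, b)" by (cases a)
  let ?v = "rev (map (\<lambda>(x, b). (x, \<not> b)) u)"
  have xu: "x \<in> X" "u \<in> gwords X" and v: "?v \<in> gwords X"
    using Cons.prems a by (auto simp: gwords_def)
  have "geq X R ([(x, \<not> b), (x, \<not> \<not> b)] @ u) ([] @ u)"
    by (intro geq_append geq_cancel geq_refl xu)
  from geq_append[OF geq_refl[OF v] this]
  have "geq X R (?v @ [(x, \<not> b), (x, b)] @ u) (?v @ u)"
    by simp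
  from geq_trans[OF this Cons.IH[OF xu(2)]] show ?case
    by (simp add: a)
qed

lemma group_presented_group: "group (presented_group X R)"
proof (rule groupI)
  fix x y assume "x \<in> carrier (presented_group X R)" "y \<in> carrier (presented_group X R)"
  then obtain u v where "x = gclass X R u" "y = gclass X R v" "u \<in> gwords X" "v \<in> gwords X"
    by (auto simp: presented_group_def)
  then show "x \<otimes>\<^bsub>presented_group X R\<^esub> y \<in> carrier (presented_group X R)"
    by (simp add: mult_gclass) (auto simp: presented_group_def gwords_def)
next
  show "\<one>\<^bsub>presented_group X R\<^esub> \<in> carrier (presented_group X R)"
    by (auto simp: presented_group_def gwords_def)
next
  fix x y z assume "x \<in> carrier (presented_group X R)" "y \<in> carrier (presented_group X R)"
    "z \<in> carrier (presented_group X R)"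
  then obtain u v w where *: "x = gclass X R u" "y = gclass X R v" "z = gclass X R w"
    "u \<in> gwords X" "v \<in> gwords X" "w \<in> gwords X"
    by (auto simp: presented_group_def)
  then have "u @ v \<in> gwords X" "v @ w \<in> gwords X"
    by (auto simp: gwords_def)
  with * show "x \<otimes>\<^bsub>presented_group X R\<^esub> y \<otimes>\<^bsub>presented_group X R\<^esub> z =
      x \<otimes>\<^bsub>presented_group X R\<^esub> (y \<otimes>\<^bsub>presented_group X R\<^esub> z)"
    by (simp add: mult_gclass)
next
  fix x assume "x \<in> carrier (presented_group X R)"
  then obtain u where u: "x = gclass X R u" "u \<in> gwords X"
    by (auto simp: presented_group_def)
  have one: "\<one>\<^bsub>presented_group X R\<^esub> = gclass X R []" and nil: "[] \<in> gwords X"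
    by (auto simp: presented_group_def gwords_def)
  show "\<one>\<^bsub>presented_group X R\<^esub> \<otimes>\<^bsub>presented_group X R\<^esub> x = x"
    by (simp add: one u nil mult_gclass)
  let ?v = "rev (map (\<lambda>(x, b). (x, \<not> b)) u)"
  have v: "?v \<in> gwords X"
    using u(2) by (auto simp: gwords_def)
  have "gclass X R ?v \<otimes>\<^bsub>presented_group X R\<^esub> x = gclass X R (?v @ u)"
    unfolding u(1) by (rule mult_gclass[OF v u(2)])
  also have "\<dots> = \<one>\<^bsub>presented_group X R\<^esub>"
    unfolding one using v u(2) nil
    by (subst gclass_eq_iff) (simp_all add: geq_left_inverse, simp add: gwords_def)
  finally show "\<exists>y\<in>carrier (presented_group X R). y \<otimes>\<^bsub>presented_group X R\<^esub> x = \<one>\<^bsub>presented_group X R\<^esub>"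
    using v by (intro bexI[of _ "gclass X R ?v"]) (simp_all add: presented_group_def)
qed


section \<open>The enveloping group\<close>

definition env_relations :: "('q, 'm) quandle_struct_scheme \<Rightarrow> ('q gword \<times> 'q gword) set" where
  "env_relations Q = {([(qop Q x y, True)], [(x, True), (y, True), (x, False)]) | x y.
     x \<in> carrier Q \<and> y \<in> carrier Q}"

definition Gr :: "('q, 'm) quandle_struct_scheme \<Rightarrow> 'q gword set monoid" where
  "Gr Q = presented_group (carrier Q) (env_relations Q)"

definition canonical :: "('q, 'm) quandle_struct_scheme \<Rightarrow> 'q \<Rightarrow> 'q gword set" where
  "canonical Q x = gclass (carrier Q) (env_relations Q) [(x, True)]"


section \<open>Thompson's quandle\<close>

definition thompson_relations :: "(nat qterm \<times> nat qterm) set" where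
  "thompson_relations = {(QOp (QGen j) (QGen k), QGen (k + 1)) | j k. j < k}"

definition thompson_quandle :: "nat qterm set quandle_struct" where
  "thompson_quandle = presented_quandle thompson_relations"

definition thompson_p :: "nat \<Rightarrow> nat qterm set" where
  "thompson_p j = qclass thompson_relations (QGen j)"


section \<open>Thompson's group\<close>

definition dyadic :: "real set" where
  "dyadic = {of_int m / 2 ^ n | (m :: int) (n :: nat). True}"

text \<open>
  The finite set \<open>B\<close> may contain points at which \<open>f\<close> is not broken. Continuity of \<open>f\<close>,
  which is imposed separately in \<open>thompson_group\<close>, justifies using closed intervals.
\<close>

definition dyadic_piecewise_linear :: "(real \<Rightarrow> real) \<Rightarrow> bool" where
  "dyadic_piecewise_linear f \<longleftrightarrow> (\<exists>B. finite B \<and> B \<subseteq> dyadic \<and>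
     (\<forall>a b. 0 \<le> a \<and> a < b \<and> b \<le> 1 \<and> {a<..<b} \<inter> B = {} \<longrightarrow>
        (\<exists>(k :: int) c. \<forall>t\<in>{a..b}. f t = 2 powi k * t + c)))"

text \<open>
  Elements of \<open>BijGroup {0..1}\<close> are maps that are undefined outside \<open>{0..1}\<close>;
  the product \<open>f \<otimes> g\<close> is the composite \<open>t \<mapsto> f (g t)\<close>.
\<close>

definition thompson_group :: "(real \<Rightarrow> real) monoid" where
  "thompson_group = (BijGroup {0..1}) \<lparr>carrier := {f \<in> Bij {0..1}.
     (\<exists>g. homeomorphism {0..1} {0..1} f g) \<and> strict_mono_on {0..1} f \<and> dyadic_piecewise_linear f}\<rparr>"

text \<open>
  The standard generators, oriented so that \<open>x\<^sub>j \<circ> x\<^sub>k \<circ> x\<^sub>j\<inverse> = x\<^sub>k\<^sub>+\<^sub>1\<close> holds for \<open>j < k\<close>: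
  the map \<open>x\<^sub>n\<close> is supported on \<open>[1 - 1/2\<^sup>n, 1]\<close>, where it is
  the rescaled copy of \<open>x\<^sub>0\<close>, which maps \<open>[0, 1/4]\<close>, \<open>[1/4, 1/2]\<close>, \<open>[1/2, 1]\<close> affinely onto
  \<open>[0, 1/2]\<close>, \<open>[1/2, 3/4]\<close>, \<open>[3/4, 1]\<close>.
\<close>

definition thompson_x :: "nat \<Rightarrow> real \<Rightarrow> real" where
  "thompson_x n = (\<lambda>t\<in>{0..1}.
     if t \<le> 1 - 1 / 2 ^ n then t
     else if t \<le> 1 - 3 / 2 ^ (n + 2) then 2 * t - (1 - 1 / 2 ^ n)
     else if t \<le> 1 - 1 / 2 ^ (n + 1) then t + 1 / 2 ^ (n + 2)
     else (t + 1) / 2)"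

end

theory Submission
  imports Defs
begin

text \<open>
  Write \<open>P\<close> for Thompson's quandle, \<open>G\<close> for its enveloping group and \<open>g\<^sub>q\<close> for the canonical
  image of \<open>q\<close> in \<open>G\<close>. The universal properties of the two presentations give a homomorphism
  \<open>\<phi>\<close> from \<open>G\<close> to Thompson's group \<open>F\<close> with \<open>g\<^sub>q \<mapsto> x\<^sub>j\<close> for \<open>q = p\<^sub>j\<close>, and an action \<open>\<alpha>\<close> of \<open>G\<close> on \<open>P\<close>
  in which \<open>g\<^sub>q\<close> acts as left multiplication by \<open>q\<close> (\<open>thompson_representations_exist\<close>). The canonical
  map turns this action into conjugation (\<open>canonical_action\<close>). Since \<open>P\<close> is the union of the orbits
  of \<open>p\<^sub>0\<close> and \<open>p\<^sub>1\<close> (\<open>orbit_representatives\<close>), the canonical map is injective as soon as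
  \<open>x\<^sub>0\<close> and \<open>x\<^sub>1\<close> are not conjugate in \<open>F\<close>, and every \<open>g\<close> for which \<open>\<phi> g\<close> commutes with \<open>x\<^sub>i\<close> fixes \<open>p\<^sub>i\<close>,
  for \<open>i = 0, 1\<close>.

  Non-conjugacy is seen on fixed points: \<open>x\<^sub>1\<close> has some in the open unit interval and \<open>x\<^sub>0\<close> has none
  (\<open>thompson_x_not_conjugate\<close>). For the stabilizers, an element of \<open>F\<close> that commutes with \<open>x\<^sub>i\<close>
  agrees on the support of \<open>x\<^sub>i\<close> with a power of \<open>x\<^sub>i\<close>: both are linear with slope a power of 2
  just to the right of the left end of the support, and commuting with \<open>x\<^sub>i\<close> spreads the
  agreement over the whole support (\<open>commuting_is_power\<close>). By idempotence, \<open>p\<^sub>i\<close> acts trivially on itself, so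
  only those \<open>g\<close> remain for which \<open>\<phi> g\<close> is the identity on that support. If \<open>i = 0\<close> this forces
  \<open>g = 1\<close> because \<open>\<phi>\<close> is injective. If \<open>i = 1\<close> then \<open>\<phi> g\<close> carries the leaf intervals of a
  binary subdivision \<open>T\<close> of the unit interval to those of another one, \<open>S\<close>, and in both the last leaf is
  the interval from \<open>1/2\<close> to \<open>1\<close>. Straightening a subdivision by rotations along its right
  edge gives a positive word in the generators (\<open>comb\<close>), and \<open>g\<close> is the quotient of the words
  for \<open>T\<close> and \<open>S\<close>. Every rotation used is some \<open>x\<^sub>j\<close> applied at a moment when the last leaf has
  depth \<open>k > j\<close>, so it moves \<open>p\<^sub>k\<close> to \<open>p\<close> with index \<open>k + 1\<close> by the defining relations of \<open>P\<close>. Hence both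
  words carry \<open>p\<^sub>1\<close> to the same generator, whose index is the number of carets, and \<open>g\<close>
  fixes \<open>p\<^sub>1\<close> (\<open>\<alpha>_comb\<close>, \<open>\<alpha>_stabilizer_1\<close>).

  That \<open>\<phi>\<close> is an isomorphism comes from the same words. It is onto because every element of \<open>F\<close>
  is described by a pair of subdivisions (\<open>subdivision_pair_exists\<close>). It is injective because every
  element of \<open>G\<close> is a quotient of two positive words (\<open>Gr_thompson_fraction\<close>), and the relations suffice
  to identify positive words that define the same map: the generator of least index can be moved to the
  right end of the word, where its exponent is read off from a slope
  (\<open>word_eq_if_F_word_eq\<close>).
\<close>

section \<open>Universal properties of presentations\<close>

definition word_value :: "('g, 'm) monoid_scheme \<Rightarrow> ('a \<Rightarrow> 'g) \<Rightarrow> 'a gword \<Rightarrow> 'g" where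
  "word_value H h w = foldr (\<lambda>(x, b) g. (if b then h x else inv\<^bsub>H\<^esub> (h x)) \<otimes>\<^bsub>H\<^esub> g) w \<one>\<^bsub>H\<^esub>"

lemma word_value_simps [simp]:
  "word_value H h [] = \<one>\<^bsub>H\<^esub>"
  "word_value H h ((x, b) # w) = (if b then h x else inv\<^bsub>H\<^esub> (h x)) \<otimes>\<^bsub>H\<^esub> word_value H h w"
  by (simp_all add: word_value_def)

lemma gwords_simps [simp]:
  "[] \<in> gwords X" "(x, b) # w \<in> gwords X \<longleftrightarrow> x \<in> X \<and> w \<in> gwords X"
  "u @ v \<in> gwords X \<longleftrightarrow> u \<in> gwords X \<and> v \<in> gwords X"
  by (auto simp: gwords_def)

lemma (in group) word_value_closed:
  assumes "h \<in> X \<rightarrow> carrier G" "w \<in> gwords X"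
  shows "word_value G h w \<in> carrier G"
  using assms(2)
proof (induction w)
  case (Cons a w)
  then show ?case using assms(1) by (cases a) auto
qed simp

lemma (in group) word_value_append:
  assumes "h \<in> X \<rightarrow> carrier G" "u \<in> gwords X" "v \<in> gwords X"
  shows "word_value G h (u @ v) = word_value G h u \<otimes> word_value G h v"
  using assms(2)
proof (induction u)
  case Nil
  then show ?case using word_value_closed[OF assms(1,3)] by simp
next
  case (Cons a u)
  then show ?case
    using word_value_closed[OF assms(1,3)] word_value_closed[OF assms(1), of u] assms(1)
    by (cases a) (auto simp: m_assoc Pi_iff)
qed

lemma (in group) presented_group_lift:
  assumes h: "h \<in> X \<rightarrow> carrier G"
    and rel: "\<And>u v. (u, v) \<in> R \<Longrightarrow> u \<in> gwords X \<Longrightarrow> v \<in> gwords X \<Longrightarrow>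
      word_value G h u = word_value G h v"
  shows "\<exists>\<phi> \<in> hom (presented_group X R) G. \<forall>x\<in>X. \<phi> (gclass X R [(x, True)]) = h x"
proof -
  have resp: "word_value G h u = word_value G h v" if "geq X R u v" for u v
    using that
  proof (induction rule: geq.induct)
    case (geq_append u u' v v')
    then show ?case
      using geq_gwords[of X R u u'] geq_gwords[of X R v v'] by (simp add: word_value_append[OF h])
  next
    case (geq_cancel x b)
    then show ?case using h by (auto simp: Pi_iff)
  qed (auto simp: rel)
  define \<phi> where "\<phi> = (\<lambda>A. the_elem (word_value G h ` A))"
  have \<phi>: "\<phi> (gclass X R u) = word_value G h u" if "u \<in> gwords X" for u
  proof -
    \<comment> \<open>A class has a single value, which \<open>the_elem\<close> extracts without choosing a representative.\<close>
    have "word_value G h ` gclass X R u = {word_value G h u}"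
      using resp[symmetric, of u] geq_refl[OF that, of R] unfolding gclass_def by blast
    then show ?thesis by (simp add: \<phi>_def)
  qed
  have "\<phi> \<in> hom (presented_group X R) G"
  proof (rule homI)
    fix a assume "a \<in> carrier (presented_group X R)"
    then show "\<phi> a \<in> carrier G"
      by (auto simp: presented_group_def \<phi> word_value_closed[OF h])
  next
    fix a b assume "a \<in> carrier (presented_group X R)" "b \<in> carrier (presented_group X R)"
    then obtain u v where "a = gclass X R u" "b = gclass X R v" "u \<in> gwords X" "v \<in> gwords X"
      by (auto simp: presented_group_def)
    then show "\<phi> (a \<otimes>\<^bsub>presented_group X R\<^esub> b) = \<phi> a \<otimes> \<phi> b"
      by (simp add: mult_gclass \<phi> word_value_append[OF h])
  qed
  moreover have "\<phi> (gclass X R [(x, True)]) = h x" if "x \<in> X" for x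
    using that h by (auto simp: \<phi> Pi_iff)
  ultimately show ?thesis by blast
qed

text \<open>
  The choice of \<open>inv_into\<close> for the left inverse is harmless: left multiplications
  in a quandle are bijective, so the preimage is unique.
\<close>

fun qterm_value :: "('q, 'm) quandle_struct_scheme \<Rightarrow> ('a \<Rightarrow> 'q) \<Rightarrow> 'a qterm \<Rightarrow> 'q" where
  "qterm_value Q k (QGen a) = k a"
| "qterm_value Q k (QOp s t) = qop Q (qterm_value Q k s) (qterm_value Q k t)"
| "qterm_value Q k (QInv s t) = inv_into (carrier Q) (qop Q (qterm_value Q k s)) (qterm_value Q k t)"

context quandle
begin

lemma qop_closed [simp, intro]: "x \<in> carrier Q \<Longrightarrow> y \<in> carrier Q \<Longrightarrow> qop Q x y \<in> carrier Q"
  using left_mult_bij bij_betwE by metis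

lemma presented_quandle_lift:
  assumes k: "\<And>a. k a \<in> carrier Q"
    and rel: "\<And>s t. (s, t) \<in> R \<Longrightarrow> qterm_value Q k s = qterm_value Q k t"
  shows "\<exists>f \<in> quandle_hom (presented_quandle R) Q. \<forall>a. f (qclass R (QGen a)) = k a"
proof -
  have inv_closed: "inv_into (carrier Q) (qop Q x) y \<in> carrier Q"
    and op_inv: "qop Q x (inv_into (carrier Q) (qop Q x) y) = y"
    and inv_op: "inv_into (carrier Q) (qop Q x) (qop Q x y) = y"
    if "x \<in> carrier Q" "y \<in> carrier Q" for x y
    using left_mult_bij[OF that(1)] that
    by (auto simp: bij_betw_def inv_into_into f_inv_into_f)
  have closed: "qterm_value Q k s \<in> carrier Q" for s
    by (induction s) (auto simp: k inv_closed)
  have resp: "qterm_value Q k s = qterm_value Q k t" if "qeq R s t" for s t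
    using that
    by (induction rule: qeq.induct) (simp_all add: rel closed op_inv inv_op left_distrib[symmetric] idem)
  define f where "f = (\<lambda>A. the_elem (qterm_value Q k ` A))"
  have f: "f (qclass R s) = qterm_value Q k s" for s
  proof -
    have "qterm_value Q k ` qclass R s = {qterm_value Q k s}"
      using resp[symmetric, of s] qeq_refl[of R s] unfolding qclass_def by blast
    then show ?thesis by (simp add: f_def)
  qed
  have "f \<in> quandle_hom (presented_quandle R) Q"
    by (auto simp: quandle_hom_def presented_quandle_def f closed
        qop_qclass[unfolded presented_quandle_def, simplified])
  moreover have "\<forall>a. f (qclass R (QGen a)) = k a"
    by (simp add: f)
  ultimately show ?thesis
    by blast
qed

section \<open>The enveloping group and its action\<close>

lemma group_Gr: "group (Gr Q)"
  unfolding Gr_def by (rule group_presented_group)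

lemma canonical_closed [simp]: "x \<in> carrier Q \<Longrightarrow> canonical Q x \<in> carrier (Gr Q)"
  by (simp add: canonical_def Gr_def presented_group_def)

lemma inv_canonical:
  assumes "x \<in> carrier Q"
  shows "inv\<^bsub>Gr Q\<^esub> (canonical Q x) = gclass (carrier Q) (env_relations Q) [(x, False)]"
proof -
  interpret G: group "Gr Q" by (rule group_Gr)
  have "gclass (carrier Q) (env_relations Q) [(x, False)] \<otimes>\<^bsub>Gr Q\<^esub> canonical Q x =
      gclass (carrier Q) (env_relations Q) [(x, False), (x, True)]"
    using assms by (simp add: canonical_def Gr_def mult_gclass)
  also have "\<dots> = \<one>\<^bsub>Gr Q\<^esub>"
    using assms geq_cancel[of x "carrier Q" "env_relations Q" False]
    by (simp add: Gr_def presented_group_def gclass_eq_iff)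
  finally show ?thesis
    using assms by (intro G.inv_equality) (auto simp: Gr_def presented_group_def canonical_def)
qed

lemma canonical_qop:
  assumes "x \<in> carrier Q" "y \<in> carrier Q"
  shows "canonical Q (qop Q x y) =
    canonical Q x \<otimes>\<^bsub>Gr Q\<^esub> canonical Q y \<otimes>\<^bsub>Gr Q\<^esub> inv\<^bsub>Gr Q\<^esub> (canonical Q x)"
proof -
  have "geq (carrier Q) (env_relations Q) [(qop Q x y, True)] [(x, True), (y, True), (x, False)]"
    using assms by (intro geq_rel) (auto simp: env_relations_def)
  then show ?thesis
    using assms unfolding inv_canonical[OF assms(1)]
    by (simp add: canonical_def Gr_def mult_gclass gclass_eq_iff)
qed

lemma Gr_induct [consumes 1, case_names one mult inv_mult]:
  assumes "g \<in> carrier (Gr Q)"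
    and "P \<one>\<^bsub>Gr Q\<^esub>"
    and "\<And>x g. x \<in> carrier Q \<Longrightarrow> g \<in> carrier (Gr Q) \<Longrightarrow> P g \<Longrightarrow> P (canonical Q x \<otimes>\<^bsub>Gr Q\<^esub> g)"
    and "\<And>x g. x \<in> carrier Q \<Longrightarrow> g \<in> carrier (Gr Q) \<Longrightarrow> P g \<Longrightarrow>
      P (inv\<^bsub>Gr Q\<^esub> (canonical Q x) \<otimes>\<^bsub>Gr Q\<^esub> g)"
  shows "P g"
proof -
  let ?c = "gclass (carrier Q) (env_relations Q)"
  obtain w where w: "w \<in> gwords (carrier Q)" and g: "g = ?c w"
    using assms(1) by (auto simp: Gr_def presented_group_def)
  have "P (?c w)"
    using w
  proof (induction w)
    case Nil
    then show ?case using assms(2) by (simp add: Gr_def presented_group_def)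
  next
    case (Cons a w)
    obtain x b where a: "a = (x, b)" by (cases a)
    from Cons.prems a have x: "x \<in> carrier Q" and w: "w \<in> gwords (carrier Q)" by auto
    have carr: "?c w \<in> carrier (Gr Q)"
      using w by (simp add: Gr_def presented_group_def)
    have split: "?c (a # w) = ?c [a] \<otimes>\<^bsub>Gr Q\<^esub> ?c w"
      using x w a by (simp add: Gr_def mult_gclass)
    show ?case
    proof (cases b)
      case True
      then show ?thesis
        using assms(3)[OF x carr Cons.IH[OF w]] split a by (simp add: canonical_def)
    next
      case False
      then show ?thesis
        using assms(4)[OF x carr Cons.IH[OF w]] split a by (simp add: inv_canonical[OF x])
    qed
  qed
  with g show ?thesis by simp
qed

lemma Gr_lift:
  assumes H: "group H" and h: "h \<in> quandle_hom Q (Conj H)"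
  shows "\<exists>\<phi> \<in> hom (Gr Q) H. \<forall>x\<in>carrier Q. \<phi> (canonical Q x) = h x"
  unfolding Gr_def canonical_def
proof (rule group.presented_group_lift[OF H])
  interpret group H by (rule H)
  show h_in: "h \<in> carrier Q \<rightarrow> carrier H"
    using h by (auto simp: quandle_hom_def Conj_def)
  fix u v assume "(u, v) \<in> env_relations Q"
  then obtain x y where "u = [(qop Q x y, True)]" "v = [(x, True), (y, True), (x, False)]"
    and xy: "x \<in> carrier Q" "y \<in> carrier Q"
    by (auto simp: env_relations_def)
  moreover have "h x \<in> carrier H" "h y \<in> carrier H"
    using h_in xy by auto
  ultimately show "word_value H h u = word_value H h v"
    using h xy by (auto simp: quandle_hom_def Conj_def m_assoc)
qed

text \<open>
  By self-distributivity every left multiplication is an automorphism of the quandle, and left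
  multiplication by \<open>x \<rhd> y\<close> is the conjugate of left multiplication by
  \<open>y\<close>. So left multiplications satisfy the relations of the enveloping group.
\<close>

lemma Gr_action:
  "\<exists>\<alpha> \<in> hom (Gr Q) (BijGroup (carrier Q)).
     \<forall>x\<in>carrier Q. \<alpha> (canonical Q x) = restrict (qop Q x) (carrier Q)"
proof (rule Gr_lift[OF group_BijGroup])
  let ?B = "BijGroup (carrier Q)" and ?L = "\<lambda>x. restrict (qop Q x) (carrier Q)"
  interpret B: group ?B by (rule group_BijGroup)
  have L: "?L x \<in> carrier ?B" if "x \<in> carrier Q" for x
    using left_mult_bij[OF that] bij_betw_cong[of "carrier Q" "?L x" "qop Q x" "carrier Q"]
    by (simp add: BijGroup_def Bij_def)
  have "?L (qop Q x y) = ?L x \<otimes>\<^bsub>?B\<^esub> ?L y \<otimes>\<^bsub>?B\<^esub> inv\<^bsub>?B\<^esub> (?L x)"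
    if xy: "x \<in> carrier Q" "y \<in> carrier Q" for x y
  proof -
    have "?L (qop Q x y) \<otimes>\<^bsub>?B\<^esub> ?L x = ?L x \<otimes>\<^bsub>?B\<^esub> ?L y"
      using xy L[OF xy(1)] L[OF xy(2)] L[OF qop_closed[OF xy]]
      by (auto simp: BijGroup_def compose_def left_distrib[symmetric] intro!: restrict_ext)
    then show ?thesis
      using L[OF xy(1)] L[OF xy(2)] L[OF qop_closed[OF xy]] by (simp add: B.inv_solve_right)
  qed
  then show "?L \<in> quandle_hom Q (Conj ?B)"
    using L by (auto simp: quandle_hom_def Conj_def)
qed

end

lemma BijGroup_apply:
  assumes "f \<in> carrier (BijGroup S)" "g \<in> carrier (BijGroup S)" "x \<in> S"
  shows "(f \<otimes>\<^bsub>BijGroup S\<^esub> g) x = f (g x)"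
  using assms by (simp add: BijGroup_def compose_def)

lemma BijGroup_maps:
  assumes "f \<in> carrier (BijGroup S)" "x \<in> S"
  shows "f x \<in> S"
  using assms by (auto simp: BijGroup_def Bij_def dest: bij_betwE)

lemma BijGroup_inv_apply:
  assumes "f \<in> carrier (BijGroup S)" "x \<in> S"
  shows "(inv\<^bsub>BijGroup S\<^esub> f) x \<in> S" "f ((inv\<^bsub>BijGroup S\<^esub> f) x) = x" "(inv\<^bsub>BijGroup S\<^esub> f) (f x) = x"
proof -
  interpret B: group "BijGroup S" by (rule group_BijGroup)
  have one: "\<one>\<^bsub>BijGroup S\<^esub> x = x"
    using assms(2) by (simp add: BijGroup_def)
  show "(inv\<^bsub>BijGroup S\<^esub> f) x \<in> S"
    using assms(2) by (rule BijGroup_maps[OF B.inv_closed[OF assms(1)]])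
  show "f ((inv\<^bsub>BijGroup S\<^esub> f) x) = x"
    using assms one BijGroup_apply[of f S "inv\<^bsub>BijGroup S\<^esub> f" x] by simp
  show "(inv\<^bsub>BijGroup S\<^esub> f) (f x) = x"
    using assms one BijGroup_apply[of "inv\<^bsub>BijGroup S\<^esub> f" S f x] by simp
qed

text \<open>
  The canonical map is equivariant, where the enveloping group acts on itself by conjugation. So
  two elements of one orbit can have the same canonical image only if they differ by an element
  that centralizes a given canonical image; injectivity on an orbit is a comparison of a
  stabilizer with a centralizer.
\<close>

lemma (in quandle) canonical_action:
  assumes \<alpha>: "\<alpha> \<in> hom (Gr Q) (BijGroup (carrier Q))"
    "\<And>x. x \<in> carrier Q \<Longrightarrow> \<alpha> (canonical Q x) = restrict (qop Q x) (carrier Q)"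
    and g: "g \<in> carrier (Gr Q)" and y: "y \<in> carrier Q"
  shows "canonical Q (\<alpha> g y) = g \<otimes>\<^bsub>Gr Q\<^esub> canonical Q y \<otimes>\<^bsub>Gr Q\<^esub> inv\<^bsub>Gr Q\<^esub> g"
proof -
  interpret G: group "Gr Q" by (rule group_Gr)
  interpret \<alpha>: group_hom "Gr Q" "BijGroup (carrier Q)" \<alpha>
    using \<alpha>(1) by (simp add: group_hom_def group_hom_axioms_def group_Gr group_BijGroup)
  from g show ?thesis
  proof (induction rule: Gr_induct)
    case one
    then show ?case using y by (simp add: BijGroup_def)
  next
    case (mult x g)
    have gy: "\<alpha> g y \<in> carrier Q"
      by (rule BijGroup_maps[OF \<alpha>.hom_closed y]) (use mult in auto)
    have "\<alpha> (canonical Q x \<otimes>\<^bsub>Gr Q\<^esub> g) y = qop Q x (\<alpha> g y)"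
      using mult y gy \<alpha>.hom_closed[of "canonical Q x"] by (simp add: BijGroup_apply \<alpha>(2))
    then show ?case
      using mult y gy by (simp add: canonical_qop G.m_assoc G.inv_mult_group)
  next
    case (inv_mult x g)
    let ?z = "\<alpha> (inv\<^bsub>Gr Q\<^esub> (canonical Q x) \<otimes>\<^bsub>Gr Q\<^esub> g) y"
    have gy: "\<alpha> g y \<in> carrier Q"
      by (rule BijGroup_maps[OF \<alpha>.hom_closed y]) (use inv_mult in auto)
    have z: "?z \<in> carrier Q"
      by (rule BijGroup_maps[OF \<alpha>.hom_closed y]) (use inv_mult in auto)
    have "?z = (inv\<^bsub>BijGroup (carrier Q)\<^esub> (\<alpha> (canonical Q x))) (\<alpha> g y)"
      using inv_mult y by (simp add: BijGroup_apply)
    then have "\<alpha> (canonical Q x) ?z = \<alpha> g y"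
      using BijGroup_inv_apply(2)[of "\<alpha> (canonical Q x)", OF _ gy] inv_mult by simp
    then have "qop Q x ?z = \<alpha> g y"
      using inv_mult z by (simp add: \<alpha>(2))
    then have "canonical Q x \<otimes>\<^bsub>Gr Q\<^esub> canonical Q ?z \<otimes>\<^bsub>Gr Q\<^esub> inv\<^bsub>Gr Q\<^esub> (canonical Q x) =
        g \<otimes>\<^bsub>Gr Q\<^esub> canonical Q y \<otimes>\<^bsub>Gr Q\<^esub> inv\<^bsub>Gr Q\<^esub> g"
      using inv_mult z by (simp flip: canonical_qop)
    then have "inv\<^bsub>Gr Q\<^esub> (canonical Q x) \<otimes>\<^bsub>Gr Q\<^esub>
          (canonical Q x \<otimes>\<^bsub>Gr Q\<^esub> canonical Q ?z \<otimes>\<^bsub>Gr Q\<^esub> inv\<^bsub>Gr Q\<^esub> (canonical Q x)) \<otimes>\<^bsub>Gr Q\<^esub> canonical Q x =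
        inv\<^bsub>Gr Q\<^esub> (canonical Q x) \<otimes>\<^bsub>Gr Q\<^esub>
          (g \<otimes>\<^bsub>Gr Q\<^esub> canonical Q y \<otimes>\<^bsub>Gr Q\<^esub> inv\<^bsub>Gr Q\<^esub> g) \<otimes>\<^bsub>Gr Q\<^esub> canonical Q x"
      by simp
    moreover have "inv\<^bsub>Gr Q\<^esub> (canonical Q x) \<otimes>\<^bsub>Gr Q\<^esub> (canonical Q x \<otimes>\<^bsub>Gr Q\<^esub> c) = c"
      if "c \<in> carrier (Gr Q)" for c
      using inv_mult that by (simp flip: G.m_assoc)
    ultimately have "canonical Q ?z = inv\<^bsub>Gr Q\<^esub> (canonical Q x) \<otimes>\<^bsub>Gr Q\<^esub>
        (g \<otimes>\<^bsub>Gr Q\<^esub> canonical Q y \<otimes>\<^bsub>Gr Q\<^esub> inv\<^bsub>Gr Q\<^esub> g) \<otimes>\<^bsub>Gr Q\<^esub> canonical Q x"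
      using inv_mult z by (simp add: G.m_assoc)
    then show ?case
      using inv_mult y by (simp add: G.m_assoc G.inv_mult_group)
  qed
qed

section \<open>Thompson's group is a group\<close>

text \<open>
  Formulated with a filter, a common denominator for several dyadic numbers comes from
  intersecting eventualities.
\<close>

lemma dyadic_iff_eventually: "x \<in> dyadic \<longleftrightarrow> (\<forall>\<^sub>F n in sequentially. x * 2 ^ n \<in> \<int>)"
proof
  assume "x \<in> dyadic"
  then obtain m :: int and N :: nat where x: "x = of_int m / 2 ^ N"
    by (auto simp: dyadic_def)
  have "x * 2 ^ n = of_int (m * 2 ^ (n - N))" if "n \<ge> N" for n
  proof -
    have "(2::real) ^ n = 2 ^ N * 2 ^ (n - N)"
      using that by (simp flip: power_add)
    then show ?thesis by (simp add: x)
  qed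
  then show "\<forall>\<^sub>F n in sequentially. x * 2 ^ n \<in> \<int>"
    unfolding eventually_sequentially by (metis Ints_of_int)
next
  assume "\<forall>\<^sub>F n in sequentially. x * 2 ^ n \<in> \<int>"
  then obtain n where "x * 2 ^ n \<in> \<int>"
    unfolding eventually_sequentially by blast
  then obtain m where "x * 2 ^ n = of_int m"
    by (auto elim: Ints_cases)
  then have "x = of_int m / 2 ^ n" by (simp add: field_simps)
  then show "x \<in> dyadic" by (auto simp: dyadic_def)
qed

lemma dyadic_add: "x \<in> dyadic \<Longrightarrow> y \<in> dyadic \<Longrightarrow> x + y \<in> dyadic"
  unfolding dyadic_iff_eventually by (auto elim: eventually_elim2 simp: distrib_right)

lemma dyadic_diff: "x \<in> dyadic \<Longrightarrow> y \<in> dyadic \<Longrightarrow> x - y \<in> dyadic"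
  unfolding dyadic_iff_eventually by (auto elim: eventually_elim2 simp: left_diff_distrib)

lemma dyadic_scale:
  assumes "x \<in> dyadic" shows "2 powi k * x \<in> dyadic"
proof -
  obtain m :: int and n :: nat where x: "x = of_int m / 2 ^ n"
    using assms by (auto simp: dyadic_def)
  show ?thesis
  proof (cases "k \<ge> 0")
    case True
    then have "2 powi k * x = of_int (m * 2 ^ nat k) / 2 ^ n"
      by (simp add: x power_int_def)
    then show ?thesis unfolding dyadic_def by blast
  next
    case False
    then have "2 powi k * x = of_int m / 2 ^ (n + nat (-k))"
      by (simp add: x power_int_def power_add field_simps)
    then show ?thesis unfolding dyadic_def by blast
  qed
qed

lemma dyadic_Ints: "x \<in> \<int> \<Longrightarrow> x \<in> dyadic"
  unfolding dyadic_def by (force elim: Ints_cases intro: exI[of _ 0])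

lemma dyadic_div_power: "x \<in> dyadic \<Longrightarrow> x / 2 ^ n \<in> dyadic"
  using dyadic_scale[of x "- int n"] by (simp add: power_int_minus field_simps)

lemma dyadic_unscale: "x \<in> dyadic \<Longrightarrow> x / 2 powi k \<in> dyadic"
  using dyadic_scale[of x "-k"] by (simp add: power_int_minus field_simps)

lemma strict_monotone_image:
  fixes f :: "real \<Rightarrow> real"
  assumes "continuous_on {0..1} f" "strict_mono_on {0..1} f" "0 \<le> a" "a \<le> b" "b \<le> 1"
  shows "f ` {a..b} = {f a..f b}" "f ` {a<..<b} = {f a<..<f b}"
proof -
  have mono: "f s < f t \<longleftrightarrow> s < t" "f s \<le> f t \<longleftrightarrow> s \<le> t" "f s = f t \<longleftrightarrow> s = t"
    if "s \<in> {0..1}" "t \<in> {0..1}" for s t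
    using strict_mono_onD[OF assms(2) that] strict_mono_onD[OF assms(2) that(2,1)]
    by (cases s t rule: linorder_cases; force)+
  have surj: "\<exists>t\<in>{a..b}. f t = y" if "y \<in> {f a..f b}" for y
    using that assms IVT'[of f a y b] continuous_on_subset[OF assms(1), of "{a..b}"] by force
  show "f ` {a..b} = {f a..f b}"
  proof (intro equalityI subsetI)
    fix y assume "y \<in> {f a..f b}"
    then show "y \<in> f ` {a..b}" using surj by blast
  qed (use assms in \<open>auto simp: mono\<close>)
  show "f ` {a<..<b} = {f a<..<f b}"
  proof (intro equalityI subsetI)
    fix y assume y: "y \<in> {f a<..<f b}"
    then obtain t where t: "t \<in> {a..b}" "y = f t"
      using surj[of y] by auto
    with y assms have "t \<in> {a<..<b}"
      by (auto simp: mono)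
    with t show "y \<in> f ` {a<..<b}" by auto
  qed (use assms in \<open>auto simp: mono\<close>)
qed

lemma thompson_group_carrier:
  "f \<in> carrier thompson_group \<longleftrightarrow> f \<in> extensional {0..1} \<and> continuous_on {0..1} f \<and>
    strict_mono_on {0..1} f \<and> f 0 = 0 \<and> f 1 = 1 \<and> dyadic_piecewise_linear f"
    (is "_ \<longleftrightarrow> ?R")
proof
  assume "f \<in> carrier thompson_group"
  then have f: "f \<in> Bij {0..1}" "strict_mono_on {0..1} f" "dyadic_piecewise_linear f"
    "continuous_on {0..1} f"
    by (auto simp: thompson_group_def homeomorphism_def)
  have img: "f ` {0..1} = {0..1}"
    using f(1) by (auto simp: Bij_def bij_betw_def)
  moreover have "f ` {0..1} = {f 0..f 1}"
    using strict_monotone_image(1)[OF f(4,2), of 0 1] by simp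
  ultimately have "f 0 = 0 \<and> f 1 = 1"
    by (simp add: Icc_eq_Icc)
  then show ?R
    using f by (auto simp: Bij_def)
next
  assume f: ?R
  then have img: "f ` {0..1} = {0..1}"
    using strict_monotone_image(1)[of f 0 1] by simp
  moreover have inj: "inj_on f {0..1}"
    using f strict_mono_on_imp_inj_on by blast
  moreover obtain g where "homeomorphism {0..1} {0..1} f g"
    using homeomorphism_compact[of "{0..1}" f "{0..1}"] img inj f by auto
  ultimately show "f \<in> carrier thompson_group"
    using f by (auto simp: thompson_group_def Bij_def bij_betw_def)
qed

lemma thompson_group_less_iff:
  assumes "f \<in> carrier thompson_group" "s \<in> {0..1}" "t \<in> {0..1}"
  shows "f s < f t \<longleftrightarrow> s < t" "f s \<le> f t \<longleftrightarrow> s \<le> t" "f s = f t \<longleftrightarrow> s = t"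
proof -
  have m: "strict_mono_on {0..1} f"
    using assms by (simp add: thompson_group_carrier)
  show "f s < f t \<longleftrightarrow> s < t" "f s \<le> f t \<longleftrightarrow> s \<le> t" "f s = f t \<longleftrightarrow> s = t"
    using strict_mono_onD[OF m assms(2,3)] strict_mono_onD[OF m assms(3,2)]
    by (cases s t rule: linorder_cases; force)+
qed

lemma thompson_group_maps:
  assumes "f \<in> carrier thompson_group" "t \<in> {0..1}"
  shows "f t \<in> {0..1}"
  using assms thompson_group_less_iff(2)[OF assms(1), of 0 t] thompson_group_less_iff(2)[OF assms(1), of t 1]
  by (simp add: thompson_group_carrier)

text \<open>
  The point \<open>b\<close> is the last breakpoint before \<open>t\<close>, or
  \<open>0\<close>. The strict inclusion of breakpoint sets makes an induction over the number
  of breakpoints to the left of \<open>t\<close> possible.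
\<close>

lemma affine_piece_left:
  assumes "finite B" "B \<subseteq> dyadic"
    and aff: "\<forall>a b. 0 \<le> a \<and> a < b \<and> b \<le> 1 \<and> {a<..<b} \<inter> B = {} \<longrightarrow>
        (\<exists>(k :: int) c. \<forall>t\<in>{a..b}. f t = 2 powi k * t + c)"
    and t: "0 < t" "t \<le> (1::real)"
  obtains b k where "0 \<le> b" "b < t" "b \<in> dyadic" "B \<inter> {0<..<b} \<subset> B \<inter> {0<..<t} \<or> b = 0"
    "f t = f b + 2 powi k * (t - b)"
proof -
  let ?S = "insert 0 (B \<inter> {0<..<t})"
  define b where "b = Max ?S"
  have fin: "finite ?S" using assms(1) by simp
  have b: "b \<in> ?S" unfolding b_def using fin by (intro Max_in) auto
  have max: "s \<le> b" if "s \<in> ?S" for s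
    unfolding b_def using fin that by simp
  have bt: "0 \<le> b" "b < t" using b t by auto
  have "{b<..<t} \<inter> B = {}"
  proof (intro equals0I)
    fix s assume "s \<in> {b<..<t} \<inter> B"
    then show False using max[of s] bt by simp
  qed
  then obtain k c where "\<forall>s\<in>{b..t}. f s = 2 powi k * s + c"
    using aff[rule_format, of b t] bt t by auto
  then have "f t = f b + 2 powi k * (t - b)"
    using bt by (simp add: algebra_simps)
  moreover have "b \<in> dyadic"
    using b assms(2) dyadic_Ints[of 0] by auto
  moreover have "B \<inter> {0<..<b} \<subset> B \<inter> {0<..<t} \<or> b = 0"
    using b bt by auto
  ultimately show thesis using that bt by blast
qed

text \<open>
  The definition of Thompson's group leaves the constants of the affine pieces arbitrary. They
  are dyadic because the first piece starts at the fixed point \<open>0\<close> and the pieces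
  meet at dyadic breakpoints. This is what keeps breakpoints dyadic under composition and
  inversion.
\<close>

lemma thompson_group_dyadic_iff:
  assumes f: "f \<in> carrier thompson_group" and t: "t \<in> {0..1}"
  shows "f t \<in> dyadic \<longleftrightarrow> t \<in> dyadic"
proof -
  obtain B where B: "finite B" "B \<subseteq> dyadic"
    and aff: "\<forall>a b. 0 \<le> a \<and> a < b \<and> b \<le> 1 \<and> {a<..<b} \<inter> B = {} \<longrightarrow>
        (\<exists>(k :: int) c. \<forall>t\<in>{a..b}. f t = 2 powi k * t + c)"
    using f unfolding thompson_group_carrier dyadic_piecewise_linear_def by blast
  have f0: "f 0 = 0" using f by (simp add: thompson_group_carrier)
  have "f t \<in> dyadic" if "t \<in> dyadic" "0 \<le> t" "t \<le> 1" for t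
    using that
  proof (induction "card (B \<inter> {0<..<t})" arbitrary: t rule: less_induct)
    case less
    show ?case
    proof (cases "t = 0")
      case True
      then show ?thesis using f0 dyadic_Ints[of 0] by simp
    next
      case False
      with less.prems have "0 < t" "t \<le> 1" by auto
      then obtain b k where b: "0 \<le> b" "b < t" "b \<in> dyadic"
        "B \<inter> {0<..<b} \<subset> B \<inter> {0<..<t} \<or> b = 0" "f t = f b + 2 powi k * (t - b)"
        by (rule affine_piece_left[OF B aff])
      have "f b \<in> dyadic"
        using b(4)
      proof
        assume "B \<inter> {0<..<b} \<subset> B \<inter> {0<..<t}"
        then have "card (B \<inter> {0<..<b}) < card (B \<inter> {0<..<t})"
          using B by (intro psubset_card_mono) auto
        then show ?thesis
          using less.hyps b less.prems by simp
      qed (use f0 dyadic_Ints[of 0] in simp)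
      then show ?thesis
        unfolding b(5) using less.prems b by (intro dyadic_add dyadic_scale dyadic_diff)
    qed
  qed note fwd = this
  have "t \<in> dyadic" if ft: "f t \<in> dyadic"
  proof (cases "t = 0")
    case True
    then show ?thesis using dyadic_Ints[of 0] by simp
  next
    case False
    with t have "0 < t" "t \<le> 1" by auto
    then obtain b k where b: "0 \<le> b" "b < t" "b \<in> dyadic" "f t = f b + 2 powi k * (t - b)"
      by (rule affine_piece_left[OF B aff])
    have "t = b + (f t - f b) / 2 powi k"
      using b(4) by simp
    moreover have "b + (f t - f b) / 2 powi k \<in> dyadic"
      using b ft fwd[of b] t by (intro dyadic_add dyadic_unscale dyadic_diff) auto
    ultimately show ?thesis by simp
  qed
  with fwd[of t] t show ?thesis by auto
qed

lemma thompson_group_pieces: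
  assumes "f \<in> carrier thompson_group"
  obtains B where "finite B" "B \<subseteq> dyadic"
    "\<forall>a b. 0 \<le> a \<and> a < b \<and> b \<le> 1 \<and> {a<..<b} \<inter> B = {} \<longrightarrow>
        (\<exists>(k :: int) c. \<forall>t\<in>{a..b}. f t = 2 powi k * t + c)"
  using assms unfolding thompson_group_carrier dyadic_piecewise_linear_def by (elim conjE exE)

lemma thompson_group_one_closed: "restrict (\<lambda>t. t) {0..1} \<in> carrier thompson_group"
proof -
  have "dyadic_piecewise_linear (restrict (\<lambda>t. t) {0..1})"
    unfolding dyadic_piecewise_linear_def
    by (rule exI[of _ "{}"]) (auto intro!: exI[of _ "0::int"] exI[of _ "0::real"])
  moreover have "continuous_on {0..1} (restrict (\<lambda>t. t) {0..1})"
    by (rule continuous_on_eq[OF continuous_on_id]) simp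
  ultimately show ?thesis
    by (auto simp: thompson_group_carrier strict_mono_on_def)
qed

lemma thompson_group_compose_closed:
  assumes f: "f \<in> carrier thompson_group" and g: "g \<in> carrier thompson_group"
  shows "compose {0..1} f g \<in> carrier thompson_group"
proof -
  have maps: "g t \<in> {0..1}" if "t \<in> {0..1}" for t
    using thompson_group_maps[OF g that] .
  obtain B where B: "finite B" "B \<subseteq> dyadic"
    and fB: "\<forall>a b. 0 \<le> a \<and> a < b \<and> b \<le> 1 \<and> {a<..<b} \<inter> B = {} \<longrightarrow>
        (\<exists>(k :: int) c. \<forall>t\<in>{a..b}. f t = 2 powi k * t + c)"
    by (rule thompson_group_pieces[OF f])
  obtain C where C: "finite C" "C \<subseteq> dyadic"
    and gC: "\<forall>a b. 0 \<le> a \<and> a < b \<and> b \<le> 1 \<and> {a<..<b} \<inter> C = {} \<longrightarrow>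
        (\<exists>(k :: int) c. \<forall>t\<in>{a..b}. g t = 2 powi k * t + c)"
    by (rule thompson_group_pieces[OF g])
  \<comment> \<open>The composite can break where \<open>g\<close> breaks and where \<open>g\<close> hits a breakpoint of \<open>f\<close>.\<close>
  let ?D = "{t \<in> {0..1}. g t \<in> B} \<union> C"
  have "inj_on g {0..1}"
    using g by (auto simp: thompson_group_carrier strict_mono_on_imp_inj_on)
  then have "finite (g -` B \<inter> {0..1})"
    using B by (intro finite_vimage_IntI) auto
  then have fin: "finite ?D"
    using C by (simp add: vimage_def Int_def conj_commute)
  have dy: "?D \<subseteq> dyadic"
    using B C thompson_group_dyadic_iff[OF g] by auto
  have "\<exists>(k :: int) c. \<forall>t\<in>{a..b}. compose {0..1} f g t = 2 powi k * t + c"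
    if ab: "0 \<le> a" "a < b" "b \<le> 1" "{a<..<b} \<inter> ?D = {}" for a b
  proof -
    obtain k c where kc: "\<And>t. t \<in> {a..b} \<Longrightarrow> g t = 2 powi k * t + c"
      using gC[rule_format, of a b] ab by (auto simp: Int_Un_distrib)
    have "g ` {a<..<b} = {g a<..<g b}"
      using strict_monotone_image(2)[of g a b] g ab by (simp add: thompson_group_carrier)
    have "{g a<..<g b} \<inter> B = {}"
    proof (intro equals0I)
      fix y assume y: "y \<in> {g a<..<g b} \<inter> B"
      with \<open>g ` {a<..<b} = {g a<..<g b}\<close> obtain t where "t \<in> {a<..<b}" "y = g t"
        by blast
      then have "t \<in> {a<..<b} \<inter> ?D" using y ab(1,3) by auto
      then show False using ab(4) by blast
    qed
    moreover have "0 \<le> g a" "g a < g b" "g b \<le> 1"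
      using ab maps[of a] maps[of b] thompson_group_less_iff[OF g] by auto
    ultimately obtain l d where ld: "\<And>t. t \<in> {g a..g b} \<Longrightarrow> f t = 2 powi l * t + d"
      using fB[rule_format, of "g a" "g b"] by auto
    have "compose {0..1} f g t = 2 powi (l + k) * t + (2 powi l * c + d)" if "t \<in> {a..b}" for t
    proof -
      have "g t \<in> {g a..g b}"
        using that ab thompson_group_less_iff[OF g] by auto
      then show ?thesis
        using that ab kc[OF that] ld[of "g t"]
        by (simp add: compose_def power_int_add algebra_simps)
    qed
    then show ?thesis by blast
  qed
  then have "dyadic_piecewise_linear (compose {0..1} f g)"
    unfolding dyadic_piecewise_linear_def using fin dy by (intro exI[of _ ?D]) simp
  moreover have sub: "g ` {0..1} \<subseteq> {0..1}"
    by (rule image_subsetI) (rule maps)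
  have "continuous_on {0..1} (\<lambda>t. f (g t))"
    by (rule continuous_on_compose2[OF _ _ sub]) (use f g in \<open>simp_all add: thompson_group_carrier\<close>)
  then have "continuous_on {0..1} (compose {0..1} f g)"
    by (rule continuous_on_eq) (simp add: compose_def)
  moreover have "strict_mono_on {0..1} (compose {0..1} f g)"
    unfolding strict_mono_on_def
    by (simp add: compose_def maps[simplified] thompson_group_less_iff(1)[OF g] thompson_group_less_iff(1)[OF f])
  ultimately show ?thesis
    using f g by (simp add: thompson_group_carrier compose_def)
qed

lemma thompson_group_inverse_closed:
  assumes g: "g \<in> carrier thompson_group"
  shows "restrict (inv_into {0..1} g) {0..1} \<in> carrier thompson_group"
proof -
  let ?h = "restrict (inv_into {0..1} g) {0..1}"
  obtain C where C: "finite C" "C \<subseteq> dyadic"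
    and gC: "\<forall>a b. 0 \<le> a \<and> a < b \<and> b \<le> 1 \<and> {a<..<b} \<inter> C = {} \<longrightarrow>
        (\<exists>(k :: int) c. \<forall>t\<in>{a..b}. g t = 2 powi k * t + c)"
    by (rule thompson_group_pieces[OF g])
  have props: "continuous_on {0..1} g" "strict_mono_on {0..1} g" "g 0 = 0" "g 1 = 1"
    using g by (auto simp: thompson_group_carrier)
  have inj: "inj_on g {0..1}" and img: "g ` {0..1} = {0..1}"
    using props strict_mono_on_imp_inj_on strict_monotone_image(1)[of g 0 1] by auto
  have hg: "?h (g t) = t" if "t \<in> {0..1}" for t
    using that inj thompson_group_maps[OF g that] by (simp add: inv_into_f_f)
  have gh: "g (?h t) = t" "?h t \<in> {0..1}" if "t \<in> {0..1}" for t
    using that img f_inv_into_f[of t g "{0..1}"] inv_into_into[of t g "{0..1}"] by auto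
  have "continuous_on (g ` {0..1}) ?h"
    by (rule continuous_on_inv[OF props(1)]) (use hg in auto)
  then have "continuous_on {0..1} ?h"
    using img by simp
  moreover have "strict_mono_on {0..1} ?h"
  proof (rule strict_mono_onI)
    fix s t :: real assume st: "s \<in> {0..1}" "t \<in> {0..1}" "s < t"
    then show "?h s < ?h t"
      using thompson_group_less_iff(1)[OF g gh(2)[OF st(1)] gh(2)[OF st(2)]] gh(1) by metis
  qed
  moreover have "?h 0 = 0" "?h 1 = 1"
    using hg[of 0] hg[of 1] props by auto
  moreover have "dyadic_piecewise_linear ?h"
    unfolding dyadic_piecewise_linear_def
  proof (intro exI[of _ "g ` (C \<inter> {0..1})"] conjI allI impI)
    show "g ` (C \<inter> {0..1}) \<subseteq> dyadic"
      using C thompson_group_dyadic_iff[OF g] by auto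
    fix a b :: real assume ab: "0 \<le> a \<and> a < b \<and> b \<le> 1 \<and> {a<..<b} \<inter> g ` (C \<inter> {0..1}) = {}"
    define a' b' where "a' = ?h a" and "b' = ?h b"
    have a': "a' \<in> {0..1}" "g a' = a" and b': "b' \<in> {0..1}" "g b' = b"
      unfolding a'_def b'_def using gh[of a] gh[of b] ab by auto
    have "a' < b'"
      using ab a' b' thompson_group_less_iff(1)[OF g a'(1) b'(1)] by simp
    moreover have "{a'<..<b'} \<inter> C = {}"
    proof (rule ccontr)
      assume "{a'<..<b'} \<inter> C \<noteq> {}"
      then obtain t where t: "t \<in> C" "a' < t" "t < b'" by auto
      then have "t \<in> {0..1}" using a' b' by auto
      moreover from this t have "g t \<in> {a<..<b}"
        using thompson_group_less_iff(1)[OF g] a' b' by (metis greaterThanLessThan_iff)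
      ultimately show False using ab t by auto
    qed
    ultimately obtain k c where kc: "\<And>t. t \<in> {a'..b'} \<Longrightarrow> g t = 2 powi k * t + c"
      using gC[rule_format, of a' b'] a' b' by auto
    have "?h t = 2 powi (-k) * t + - c / 2 powi k" if t: "t \<in> {a..b}" for t
    proof -
      have t01: "t \<in> {0..1}" using t ab by auto
      have "?h t \<in> {a'..b'}"
        using t a' b' gh[OF t01] thompson_group_less_iff(2)[OF g] by (metis atLeastAtMost_iff)
      from kc[OF this] gh(1)[OF t01] have "t = 2 powi k * ?h t + c"
        by (simp only:)
      then have "?h t * 2 powi k = t - c"
        by (simp only: mult.commute[of "?h t"] add_diff_cancel)
      then have "?h t = (t - c) / 2 powi k"
        by (subst nonzero_eq_divide_eq) simp_all
      then show ?thesis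
        by (simp only: power_int_minus diff_divide_distrib) (simp add: field_simps)
    qed
    then show "\<exists>(k :: int) c. \<forall>t\<in>{a..b}. ?h t = 2 powi k * t + c" by blast
  qed (use C in auto)
  ultimately show ?thesis
    by (simp add: thompson_group_carrier)
qed

lemma thompson_subgroup: "subgroup (carrier thompson_group) (BijGroup {0..1})"
proof -
  interpret B: group "BijGroup {0..1::real}" by (rule group_BijGroup)
  have sub: "carrier thompson_group \<subseteq> carrier (BijGroup {0..1})"
    by (auto simp: thompson_group_def BijGroup_def)
  show ?thesis
  proof (rule B.subgroupI[OF sub])
    show "carrier thompson_group \<noteq> {}"
      using thompson_group_one_closed by blast
  next
    fix a assume a: "a \<in> carrier thompson_group"
    then show "inv\<^bsub>BijGroup {0..1}\<^esub> a \<in> carrier thompson_group"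
      using thompson_group_inverse_closed[OF a] inv_BijGroup[of a "{0..1}"] sub
      by (auto simp: BijGroup_def)
  next
    fix a b assume ab: "a \<in> carrier thompson_group" "b \<in> carrier thompson_group"
    then show "a \<otimes>\<^bsub>BijGroup {0..1}\<^esub> b \<in> carrier thompson_group"
      using thompson_group_compose_closed[OF ab] sub by (simp add: BijGroup_def subset_iff)
  qed
qed

lemma group_thompson_group: "group thompson_group"
  using subgroup.subgroup_is_group[OF thompson_subgroup group_BijGroup]
  by (simp add: thompson_group_def)

lemma thompson_group_mult_apply:
  assumes "f \<in> carrier thompson_group" "g \<in> carrier thompson_group" "t \<in> {0..1}"
  shows "(f \<otimes>\<^bsub>thompson_group\<^esub> g) t = f (g t)"
  using BijGroup_apply[of f "{0..1}" g t] assms subgroup.subset[OF thompson_subgroup]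
  by (auto simp: thompson_group_def)

lemma thompson_group_one_apply: "t \<in> {0..1} \<Longrightarrow> \<one>\<^bsub>thompson_group\<^esub> t = t"
  by (simp add: thompson_group_def BijGroup_def)

lemma thompson_group_eqI:
  assumes "f \<in> carrier thompson_group" "g \<in> carrier thompson_group" "\<And>t. t \<in> {0..1} \<Longrightarrow> f t = g t"
  shows "f = g"
  using assms by (intro extensionalityI[of f "{0..1}" g]) (auto simp: thompson_group_carrier)

section \<open>The standard generators\<close>

text \<open>
  The generator with support from \<open>1 - e\<close> to \<open>1\<close>, for \<open>e =
  1/2\<^sup>n\<close>. On its support it is concave, hence a minimum of affine maps; in this
  form continuity and monotonicity are immediate.
\<close>

definition stretch :: "real \<Rightarrow> real \<Rightarrow> real" where
  "stretch e t = max t (min (2 * t - (1 - e)) (min (t + e / 4) ((t + 1) / 2)))"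

lemma stretch_pieces:
  assumes "e > 0"
  shows "t \<le> 1 - e \<Longrightarrow> stretch e t = t"
    and "1 - e \<le> t \<Longrightarrow> t \<le> 1 - 3 * e / 4 \<Longrightarrow> stretch e t = 2 * t - (1 - e)"
    and "1 - 3 * e / 4 \<le> t \<Longrightarrow> t \<le> 1 - e / 2 \<Longrightarrow> stretch e t = t + e / 4"
    and "1 - e / 2 \<le> t \<Longrightarrow> t \<le> 1 \<Longrightarrow> stretch e t = (t + 1) / 2"
  using assms by (auto simp: stretch_def min_def max_def)

lemma stretch_strict_mono: "s < t \<Longrightarrow> stretch e s < stretch e t"
  by (auto simp: stretch_def min_def max_def)

lemma stretch_ge: "t \<le> stretch e t"
  by (simp add: stretch_def)

lemma stretch_gt: "e > 0 \<Longrightarrow> 1 - e < t \<Longrightarrow> t < 1 \<Longrightarrow> t < stretch e t"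
  by (auto simp: stretch_def min_def max_def)

lemma stretch_le_1: "e > 0 \<Longrightarrow> t \<le> 1 \<Longrightarrow> stretch e t \<le> 1"
  by (auto simp: stretch_def min_def max_def)

text \<open>
  This is the defining relation of the generators: the outer map is affine with slope
  \<open>1/2\<close> on the support of the inner one, and conjugation by it shrinks that support
  to half its length.
\<close>

lemma stretch_commute:
  assumes "0 < d" "d \<le> e / 2" "t \<le> 1"
  shows "stretch e (stretch d t) = stretch (d / 2) (stretch e t)"
proof (cases "t \<le> 1 - d")
  case True
  then have d: "stretch d t = t"
    using assms by (simp add: stretch_pieces)
  have "stretch e t \<le> stretch e (1 - d)"
    using True stretch_strict_mono[of t "1 - d" e] by (cases "t = 1 - d") auto
  also have "\<dots> = 1 - d / 2"
    using assms stretch_pieces(4)[of e "1 - d"] by (simp add: field_simps)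
  finally show ?thesis
    using assms d by (simp add: stretch_pieces)
next
  case False
  then have "1 - e / 2 \<le> stretch d t" "stretch d t \<le> 1"
    using assms stretch_ge[of t d] stretch_le_1[of d t] by auto
  then have "stretch e (stretch d t) = (stretch d t + 1) / 2" "stretch e t = (t + 1) / 2"
    using assms False by (simp_all add: stretch_pieces(4)[of e])
  moreover have "(stretch d t + 1) / 2 = stretch (d / 2) ((t + 1) / 2)"
    by (auto simp: stretch_def min_def max_def field_simps)
  ultimately show ?thesis
    by (simp only:)
qed

lemma thompson_x_stretch:
  assumes "t \<in> {0..1}" shows "thompson_x n t = stretch (1 / 2 ^ n) t"
proof -
  define e :: real where "e = 1 / 2 ^ n"
  have e: "e > 0" by (simp add: e_def)
  have "thompson_x n t = (if t \<le> 1 - e then t else if t \<le> 1 - 3 * e / 4 then 2 * t - (1 - e)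
      else if t \<le> 1 - e / 2 then t + e / 4 else (t + 1) / 2)"
    using assms by (simp add: thompson_x_def e_def)
  also have "\<dots> = stretch e t"
    using e assms by (auto simp: stretch_pieces)
  finally show ?thesis by (simp add: e_def)
qed

lemma thompson_x_closed [simp]: "thompson_x n \<in> carrier thompson_group"
proof -
  define e :: real where "e = 1 / 2 ^ n"
  have e: "e > 0" "e \<le> 1" by (auto simp: e_def)
  have x: "thompson_x n t = stretch e t" if "t \<in> {0..1}" for t
    using thompson_x_stretch[OF that] by (simp add: e_def)
  let ?B = "{1 - e, 1 - 3 * e / 4, 1 - e / 2}"
  have "dyadic_piecewise_linear (thompson_x n)"
    unfolding dyadic_piecewise_linear_def
  proof (intro exI[of _ ?B] conjI allI impI)
    have "c / 2 ^ m \<in> dyadic" if "c \<in> \<int>" for c m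
      using that by (intro dyadic_div_power dyadic_Ints)
    from this[of 1 n] this[of 3 "n + 2"] this[of 1 "n + 1"]
    have "e \<in> dyadic" "3 * e / 4 \<in> dyadic" "e / 2 \<in> dyadic"
      by (simp_all add: e_def mult.commute)
    then show "?B \<subseteq> dyadic"
      using dyadic_Ints[of 1] by (auto intro!: dyadic_diff)
    fix a b :: real assume ab: "0 \<le> a \<and> a < b \<and> b \<le> 1 \<and> {a<..<b} \<inter> ?B = {}"
    then have not: "\<not> (a < c \<and> c < b)" if "c \<in> ?B" for c
      using that by (auto simp: disjoint_iff)
    consider "b \<le> 1 - e" | "1 - e \<le> a" "b \<le> 1 - 3 * e / 4" | "1 - 3 * e / 4 \<le> a" "b \<le> 1 - e / 2"
      | "1 - e / 2 \<le> a"
      using not[of "1 - e"] not[of "1 - 3 * e / 4"] not[of "1 - e / 2"] ab e by simp linarith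
    then show "\<exists>(k :: int) c. \<forall>t\<in>{a..b}. thompson_x n t = 2 powi k * t + c"
    proof cases
      case 1
      then show ?thesis
        using ab e by (intro exI[of _ 0] exI[of _ 0]) (simp add: x stretch_pieces)
    next
      case 2
      then show ?thesis
        using ab e by (intro exI[of _ 1] exI[of _ "- (1 - e)"]) (simp add: x stretch_pieces)
    next
      case 3
      then show ?thesis
        using ab e by (intro exI[of _ 0] exI[of _ "e / 4"]) (simp add: x stretch_pieces)
    next
      case 4
      then show ?thesis
        using ab e by (intro exI[of _ "-1"] exI[of _ "1 / 2"]) (simp add: x stretch_pieces field_simps)
    qed
  qed simp
  moreover have "continuous_on {0..1} (stretch e)"
    unfolding stretch_def by (intro continuous_intros) simp_all
  then have "continuous_on {0..1} (thompson_x n)"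
    by (rule continuous_on_eq) (simp add: x)
  moreover have "strict_mono_on {0..1} (thompson_x n)"
    by (rule strict_mono_onI) (simp add: x stretch_strict_mono)
  moreover have "thompson_x n 0 = 0" "thompson_x n 1 = 1"
    using e by (simp_all add: x stretch_pieces)
  ultimately show ?thesis
    by (auto simp: thompson_group_carrier thompson_x_def)
qed

section \<open>Positive words\<close>

text \<open>
  Rewriting positive words uses only the relations between the generators, so it applies both to
  the enveloping group of Thompson's quandle and to Thompson's group.
\<close>

locale thompson_family = group G for G (structure) +
  fixes x :: "nat \<Rightarrow> 'a"
  assumes x_closed [simp]: "x j \<in> carrier G"
    and x_commute: "j < k \<Longrightarrow> x j \<otimes> x k = x (Suc k) \<otimes> x j"
begin

definition word :: "nat list \<Rightarrow> 'a" where
  "word u = foldr (\<lambda>j g. x j \<otimes> g) u \<one>"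

lemma word_simps [simp]: "word [] = \<one>" "word (j # u) = x j \<otimes> word u"
  by (simp_all add: word_def)

lemma word_closed [simp]: "word u \<in> carrier G"
  by (induction u) auto

lemma word_append: "word (u @ v) = word u \<otimes> word v"
  by (induction u) (auto simp: m_assoc)

end

text \<open>
  Moves all letters \<open>n\<close> of a word to its right end and counts them. A letter
  \<open>n\<close> that passes a larger letter \<open>k\<close> turns it into \<open>k +
  1\<close>. As a function on words, it performs the same rewriting in any two groups that
  satisfy the relations.
\<close>

fun collect :: "nat \<Rightarrow> nat list \<Rightarrow> nat list \<times> nat" where
  "collect n [] = ([], 0)"
| "collect n (j # u) =
    (case collect n u of (w, a) \<Rightarrow> if j = n then (map Suc w, Suc a) else (j # w, a))"

lemma collect_greater: "collect n u = (w, a) \<Longrightarrow> \<forall>j\<in>set u. n \<le> j \<Longrightarrow> \<forall>j\<in>set w. n < j"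
  by (induction u arbitrary: w a) (fastforce split: prod.splits if_splits)+

lemma collect_length: "collect n u = (w, a) \<Longrightarrow> length w + a = length u"
  by (induction u arbitrary: w a) (fastforce split: prod.splits if_splits)+

lemma collect_mem: "collect n u = (w, a) \<Longrightarrow> n \<in> set u \<Longrightarrow> a > 0"
  by (induction u arbitrary: w a) (fastforce split: prod.splits if_splits)+

context thompson_family
begin

lemma word_shift: "\<forall>k\<in>set w. n < k \<Longrightarrow> x n \<otimes> word w = word (map Suc w) \<otimes> x n"
proof (induction w)
  case (Cons k w)
  have "x n \<otimes> word (k # w) = (x n \<otimes> x k) \<otimes> word w"
    by (simp add: m_assoc)
  also have "\<dots> = x (Suc k) \<otimes> (x n \<otimes> word w)"
    using Cons.prems by (simp add: x_commute m_assoc)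
  finally show ?case
    using Cons by (simp add: m_assoc)
qed simp

lemma word_collect:
  "collect n u = (w, a) \<Longrightarrow> \<forall>j\<in>set u. n \<le> j \<Longrightarrow> word u = word w \<otimes> word (replicate a n)"
proof (induction u arbitrary: w a)
  case (Cons j u)
  obtain w' a' where c: "collect n u = (w', a')" by (cases "collect n u")
  have IH: "word u = word w' \<otimes> word (replicate a' n)"
    using Cons.IH[OF c] Cons.prems by simp
  show ?case
  proof (cases "j = n")
    case True
    have "\<forall>j\<in>set w'. n < j"
      using collect_greater[OF c] Cons.prems by simp
    from word_shift[OF this] show ?thesis
      using Cons.prems c True IH by (auto simp flip: m_assoc)
  qed (use Cons.prems c IH in \<open>auto simp: m_assoc\<close>)
qed simp

text \<open>
  Two letters have a common left multiple with cofactors of length at most one, and this bound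
  is what lets the induction over \<open>v\<close> continue: the cofactor of \<open>v\<close>
  never grows beyond a single letter.
\<close>

lemma common_multiple_letter:
  "\<exists>v' p. word v' \<otimes> x j = word p \<otimes> word v \<and> length p \<le> 1"
proof (induction v arbitrary: j rule: rev_induct)
  case Nil
  show ?case by (intro exI[of _ "[]"] exI[of _ "[j]"]) simp
next
  case (snoc k v)
  show ?case
  proof (cases "j = k")
    case True
    then show ?thesis
      by (intro exI[of _ v] exI[of _ "[]"]) (simp add: word_append)
  next
    case False
    then obtain i l where il: "x l \<otimes> x j = x i \<otimes> x k"
      using x_commute[of j k] x_commute[of k j] by (metis linorder_neqE_nat)
    obtain v' p where p: "word v' \<otimes> x i = word p \<otimes> word v" "length p \<le> 1"
      using snoc.IH by blast
    have "word (v' @ [l]) \<otimes> x j = word v' \<otimes> x i \<otimes> x k"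
      by (simp add: word_append m_assoc il)
    also have "\<dots> = word p \<otimes> word (v @ [k])"
      by (simp add: p word_append m_assoc)
    finally show ?thesis using p(2) by blast
  qed
qed

lemma common_multiple: "\<exists>u' v'. word v' \<otimes> word u = word u' \<otimes> word v"
proof (induction u arbitrary: v rule: rev_induct)
  case Nil
  show ?case by (intro exI[of _ "[]"] exI[of _ v]) simp
next
  case (snoc j u)
  obtain v1 p where p: "word v1 \<otimes> x j = word p \<otimes> word v"
    using common_multiple_letter by blast
  obtain u2 v2 where "word v2 \<otimes> word u = word u2 \<otimes> word v1"
    using snoc.IH by blast
  then have "word v2 \<otimes> word (u @ [j]) = word u2 \<otimes> (word v1 \<otimes> x j)"
    by (simp add: word_append flip: m_assoc)
  also have "\<dots> = word (u2 @ p) \<otimes> word v"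
    by (simp add: p word_append m_assoc)
  finally show ?case by blast
qed

text \<open>
  Common left multiples are the Ore condition, which turns a product of two left fractions into
  a left fraction.
\<close>

lemma fractions_subgroup: "subgroup {inv (word v) \<otimes> word u | u v. True} G"
proof (rule subgroupI)
  fix a b assume "a \<in> {inv (word v) \<otimes> word u | u v. True}" "b \<in> {inv (word v) \<otimes> word u | u v. True}"
  then obtain u v p q where ab: "a = inv (word v) \<otimes> word u" "b = inv (word q) \<otimes> word p"
    by blast
  obtain u' q' where q: "word q' \<otimes> word u = word u' \<otimes> word q"
    using common_multiple by blast
  have "word u = inv (word q') \<otimes> (word u' \<otimes> word q)"
    by (simp add: m_assoc[symmetric] flip: q)
  then have "a \<otimes> b = inv (word v) \<otimes> inv (word q') \<otimes> word u' \<otimes> (word q \<otimes> inv (word q)) \<otimes> word p"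
    unfolding ab using r_inv[OF word_closed[of q]]
    by (simp add: m_assoc[symmetric] del: r_inv) (simp add: m_assoc)
  also have "\<dots> = inv (word (q' @ v)) \<otimes> word (u' @ p)"
    by (simp add: word_append inv_mult_group m_assoc)
  finally show "a \<otimes> b \<in> {inv (word v) \<otimes> word u | u v. True}" by blast
next
  fix a assume "a \<in> {inv (word v) \<otimes> word u | u v. True}"
  then obtain u v where "a = inv (word v) \<otimes> word u" by blast
  then have "inv a = inv (word u) \<otimes> word v"
    by (simp add: inv_mult_group)
  then show "inv a \<in> {inv (word v) \<otimes> word u | u v. True}" by blast
qed auto

end

interpretation F: thompson_family thompson_group thompson_x
proof -
  interpret group thompson_group by (rule group_thompson_group)
  show "thompson_family thompson_group thompson_x"
  proof
    fix j k :: nat assume jk: "j < k"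
    have "(1::real) / 2 ^ k \<le> 1 / 2 ^ j / 2"
      using jk power_increasing[of "Suc j" k "2::real"] by (simp add: field_simps)
    then have "thompson_x j (thompson_x k t) = thompson_x (Suc k) (thompson_x j t)"
      if "t \<in> {0..1}" for t
      using that stretch_commute[of "1 / 2 ^ k" "1 / 2 ^ j" t]
        thompson_group_maps[OF thompson_x_closed that]
      by (simp add: thompson_x_stretch mult.commute)
    then show "thompson_x j \<otimes>\<^bsub>thompson_group\<^esub> thompson_x k =
        thompson_x (Suc k) \<otimes>\<^bsub>thompson_group\<^esub> thompson_x j"
      by (intro thompson_group_eqI) (simp_all add: thompson_group_mult_apply)
  qed simp
qed

lemma F_word_Cons_apply: "t \<in> {0..1} \<Longrightarrow> F.word (j # u) t = stretch (1 / 2 ^ j) (F.word u t)"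
  using thompson_group_maps[OF F.word_closed, of t u]
  by (simp add: thompson_group_mult_apply thompson_x_stretch del: atLeastAtMost_iff)

lemma F_word_append_apply: "t \<in> {0..1} \<Longrightarrow> F.word (u @ v) t = F.word u (F.word v t)"
  by (simp add: F.word_append thompson_group_mult_apply)

lemma F_word_Nil_apply: "t \<in> {0..1} \<Longrightarrow> F.word [] t = t"
  by (simp add: thompson_group_one_apply)

lemma F_word_fixes:
  assumes "\<forall>j\<in>set u. n \<le> j" "0 \<le> t" "t \<le> 1 - 1 / 2 ^ n"
  shows "F.word u t = t"
proof -
  have t: "t \<in> {0..1}"
  proof -
    have "(0::real) \<le> 1 / 2 ^ n" by simp
    then have "t \<le> 1" using assms(3) by linarith
    then show ?thesis using assms(2) by simp
  qed
  show ?thesis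
    using assms(1)
  proof (induction u)
    case Nil
    then show ?case using t by (simp only: F_word_Nil_apply)
  next
    case (Cons j u)
    have "(1::real) / 2 ^ j \<le> 1 / 2 ^ n"
      using Cons.prems by (simp add: field_simps)
    then show ?case
      using Cons t assms(3) by (simp only: F_word_Cons_apply) (simp add: stretch_pieces)
  qed
qed

lemma F_word_replicate:
  assumes "0 \<le> s" "2 ^ a * s \<le> 1 / 2 ^ n / 2"
  shows "F.word (replicate a n) (1 - 1 / 2 ^ n + s) = 1 - 1 / 2 ^ n + 2 ^ a * s"
proof -
  define e :: real where "e = 1 / 2 ^ n"
  have e: "0 < e" "e \<le> 1" by (auto simp: e_def)
  have "s \<le> 2 ^ a * s"
    using assms(1) mult_right_mono[of 1 "2 ^ a" s] by simp
  then have "s \<le> e"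
    using assms e by (simp add: e_def)
  then have t: "1 - e + s \<in> {0..1}"
    using assms(1) e by simp
  show ?thesis
    using assms(2)
  proof (induction a)
    case 0
    then show ?case using t by (simp only: replicate_0 F_word_Nil_apply e_def) simp
  next
    case (Suc a)
    then have le: "2 ^ a * s \<le> e / 4"
      by (simp add: e_def)
    moreover have "e / 4 \<le> 1 / 2 ^ n / 2"
      using e(1) by (simp only: e_def[symmetric])
    ultimately have "F.word (replicate a n) (1 - e + s) = 1 - e + 2 ^ a * s"
      unfolding e_def by (intro Suc.IH) (rule order_trans)
    moreover have "stretch e (1 - e + 2 ^ a * s) = 1 - e + 2 * (2 ^ a * s)"
      using stretch_pieces(2)[OF e(1), of "1 - e + 2 ^ a * s"] assms(1) le by simp
    ultimately show ?case
      using F_word_Cons_apply[OF t, of n "replicate a n"] by (simp add: e_def)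
  qed
qed

text \<open>
  Faithfulness of positive words on the unit interval. Let \<open>n\<close> be the least letter
  of both words, and collect its occurrences on the right. The remaining letters exceed
  \<open>n\<close> and act trivially up to the point \<open>1 -
  1/2\<^sup>n\<^sup>+\<^sup>1\<close>, so the slope of the map just to the right of \<open>1 -
  1/2\<^sup>n\<close> is the power of 2 whose exponent counts the letters \<open>n\<close>.
  Equal maps thus have equally many of them; cancelling them shortens the words.
\<close>

lemma (in thompson_family) word_eq_if_F_word_eq:
  "F.word u = F.word v \<Longrightarrow> word u = word v"
proof (induction "length u + length v" arbitrary: u v rule: less_induct)
  case less
  show ?case
  proof (cases "u = [] \<and> v = []")
    case False
    define n where "n = Min (set u \<union> set v)"
    have "n \<in> set u \<union> set v"
      unfolding n_def using False by (intro Min_in) auto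
    have ge: "\<forall>j\<in>set u. n \<le> j" "\<forall>j\<in>set v. n \<le> j"
      by (auto simp: n_def)
    obtain u' a where u': "collect n u = (u', a)" by (cases "collect n u")
    obtain v' b where v': "collect n v = (v', b)" by (cases "collect n v")
    have u: "word u = word u' \<otimes> word (replicate a n)" "F.word u = F.word (u' @ replicate a n)"
      using word_collect[OF u' ge(1)] F.word_collect[OF u' ge(1)] by (auto simp: F.word_append)
    have v: "word v = word v' \<otimes> word (replicate b n)" "F.word v = F.word (v' @ replicate b n)"
      using word_collect[OF v' ge(2)] F.word_collect[OF v' ge(2)] by (auto simp: F.word_append)
    have gr: "\<forall>j\<in>set u'. Suc n \<le> j" "\<forall>j\<in>set v'. Suc n \<le> j"
      using collect_greater[OF u' ge(1)] collect_greater[OF v' ge(2)] by auto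
    define e :: real where "e = 1 / 2 ^ n"
    \<comment> \<open>The point at distance \<open>s\<close> from the left end of the support stays in the doubling zone of
      generator \<open>n\<close> through \<open>a\<close> as well as through \<open>b\<close> applications.\<close>
    define s where "s = e / 2 / 2 ^ (a + b)"
    have e: "0 < e" "e \<le> 1" by (auto simp: e_def)
    have s: "0 < s" using e by (simp add: s_def)
    have "(2::real) ^ a \<le> 2 ^ (a + b)" "(2::real) ^ b \<le> 2 ^ (a + b)"
      by (intro power_increasing; simp)+
    then have as: "2 ^ a * s \<le> e / 2" and bs: "2 ^ b * s \<le> e / 2"
      using e by (simp_all add: s_def divide_simps)
    have "s \<le> 2 ^ a * s"
      using s mult_right_mono[of 1 "2 ^ a" s] by simp
    then have "s \<le> e"
      using as e by linarith
    then have t: "1 - e + s \<in> {0..1}"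
      using s e by simp
    have half: "1 / 2 ^ Suc n = e / 2" by (simp add: e_def)
    have ua: "F.word u (1 - e + s) = 1 - e + 2 ^ a * s"
      unfolding u(2) F_word_append_apply[OF t]
      using F_word_replicate[of s a n] F_word_fixes[OF gr(1), of "1 - e + 2 ^ a * s"] s as e half
      by (simp add: e_def[symmetric] del: power_Suc)
    have vb: "F.word v (1 - e + s) = 1 - e + 2 ^ b * s"
      unfolding v(2) F_word_append_apply[OF t]
      using F_word_replicate[of s b n] F_word_fixes[OF gr(2), of "1 - e + 2 ^ b * s"] s bs e half
      by (simp add: e_def[symmetric] del: power_Suc)
    have "2 ^ a * s = 2 ^ b * s"
      using ua vb unfolding less.prems by linarith
    then have ab: "a = b"
      using s by simp
    have "F.word u' = F.word v'"
      using less.prems u(2) v(2) ab by (simp add: F.word_append)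
    moreover have "length u' + length v' < length u + length v"
      using collect_length[OF u'] collect_length[OF v'] \<open>n \<in> set u \<union> set v\<close>
        collect_mem[OF u'] collect_mem[OF v'] by auto
    ultimately have "word u' = word v'"
      using less.hyps by blast
    then show ?thesis
      using u v ab by simp
  qed simp
qed

section \<open>Binary subdivisions and their straightening\<close>

text \<open>
  A cell is an interval, given by its left end and its length.
\<close>

type_synonym cell = "real \<times> real"

text \<open>
  The affine bijection between two cells; the first one has to lie in the unit interval, where
  elements of Thompson's group are defined.
\<close>

definition maps_cell :: "(real \<Rightarrow> real) \<Rightarrow> cell \<Rightarrow> cell \<Rightarrow> bool" where
  "maps_cell f c d \<longleftrightarrow> 0 \<le> fst c \<and> 0 < snd c \<and> fst c + snd c \<le> 1 \<and>
     (\<forall>t\<in>{fst c..fst c + snd c}. f t = fst d + (t - fst c) * (snd d / snd c))"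

datatype subdivision = Leaf | Node subdivision subdivision

fun cells :: "subdivision \<Rightarrow> cell \<Rightarrow> cell list" where
  "cells Leaf c = [c]"
| "cells (Node l r) (a, h) = cells l (a, h / 2) @ cells r (a + h / 2, h / 2)"

fun carets :: "subdivision \<Rightarrow> nat" where
  "carets Leaf = 0"
| "carets (Node l r) = Suc (carets l + carets r)"

fun right_depth :: "subdivision \<Rightarrow> nat" where
  "right_depth Leaf = 0"
| "right_depth (Node l r) = Suc (right_depth r)"

fun vine :: "nat \<Rightarrow> subdivision" where
  "vine 0 = Leaf"
| "vine (Suc n) = Node Leaf (vine n)"

text \<open>
  A rotation moves a subtree from a left to a right position. As left subtrees count twice, it
  decreases this weight.
\<close>

fun left_weight :: "subdivision \<Rightarrow> nat" where
  "left_weight Leaf = 0"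
| "left_weight (Node l r) = Suc (2 * left_weight l + left_weight r)"

text \<open>
  Place a subdivision \<open>T\<close> in the interval from \<open>1 - 1/2\<^sup>i\<close> to
  \<open>1\<close>. Applying the generator \<open>x\<^sub>i\<close> there rotates the root of
  \<open>T\<close>, which pushes part of its left subtree to the right. Once the left subtree is
  a leaf, the right subtree lies in the next such interval. The word of all these generators,
  the first rotation written last, straightens \<open>T\<close> to the vine with the same number
  of leaves.
\<close>

function comb :: "nat \<Rightarrow> subdivision \<Rightarrow> nat list" where
  "comb i Leaf = []"
| "comb i (Node Leaf r) = comb (Suc i) r"
| "comb i (Node (Node a b) r) = comb i (Node a (Node b r)) @ [i]"
  by pat_completeness auto
termination by (relation "Wellfounded.measure (\<lambda>(i, T). left_weight T)") auto

lemma length_cells: "length (cells T c) = Suc (carets T)"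
  by (induction T c rule: cells.induct) auto

lemma comb_ge: "j \<in> set (comb i T) \<Longrightarrow> i \<le> j"
  by (induction i T rule: comb.induct) auto

lemma maps_cell_halves:
  assumes "maps_cell f (a, h) (b, m)"
  shows "maps_cell f (a, h / 2) (b, m / 2)" "maps_cell f (a + h / 2, h / 2) (b + m / 2, m / 2)"
  using assms by (auto simp: maps_cell_def field_simps)

lemma maps_cell_cells:
  "maps_cell f c d \<Longrightarrow> list_all2 (maps_cell f) (cells T c) (cells T d)"
proof (induction T arbitrary: c d)
  case (Node l r)
  obtain a h b m where "c = (a, h)" "d = (b, m)" by (cases c, cases d)
  with Node show ?case
    using maps_cell_halves[of f a h b m] by (simp add: list_all2_appendI)
qed simp

lemma maps_cell_trans:
  assumes "maps_cell g c d" "maps_cell f d e"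
    and "\<And>t. t \<in> {0..1} \<Longrightarrow> h t = f (g t)"
  shows "maps_cell h c e"
proof -
  have c: "0 \<le> fst c" "0 < snd c" "fst c + snd c \<le> 1" and d: "0 < snd d"
    using assms by (auto simp: maps_cell_def)
  have "h t = fst e + (t - fst c) * (snd e / snd c)" if t: "t \<in> {fst c..fst c + snd c}" for t
  proof -
    have "t \<in> {0..1}" using t c by auto
    define s where "s = (t - fst c) / snd c"
    have s: "0 \<le> s" "s \<le> 1" using t c by (auto simp: s_def)
    have g: "g t = fst d + s * snd d"
      using assms(1) t by (simp add: maps_cell_def s_def)
    moreover have "0 \<le> s * snd d" "s * snd d \<le> snd d"
      using s d by (auto intro: mult_left_le_one_le)
    ultimately have "g t \<in> {fst d..fst d + snd d}" by simp
    then have "f (g t) = fst e + (g t - fst d) * (snd e / snd d)"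
      using assms(2) unfolding maps_cell_def by blast
    also have "\<dots> = fst e + s * snd e"
      using g d by simp
    finally show ?thesis
      using assms(3)[OF \<open>t \<in> {0..1}\<close>] by (simp add: s_def)
  qed
  with c show ?thesis unfolding maps_cell_def by blast
qed

lemma list_all2_maps_cell_trans:
  assumes "list_all2 (maps_cell g) cs ds" "list_all2 (maps_cell f) ds es"
    and "\<And>t. t \<in> {0..1} \<Longrightarrow> h t = f (g t)"
  shows "list_all2 (maps_cell h) cs es"
  by (rule list_all2_trans[OF _ assms(1,2)])
    (rule maps_cell_trans, assumption, assumption, rule assms(3))

text \<open>
  A map is determined by where it takes the leaves of a subdivision, because the leaves cover
  the subdivided cell.
\<close>

lemma maps_cells_agree:
  assumes "list_all2 (maps_cell f) (cells T c) ds" "list_all2 (maps_cell g) (cells T c) ds"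
    and "t \<in> {fst c..fst c + snd c}"
  shows "f t = g t"
  using assms
proof (induction T arbitrary: c ds)
  case Leaf
  then show ?case
    by (auto simp: maps_cell_def list_all2_Cons1)
next
  case (Node l r)
  obtain a h where c: "c = (a, h)" by (cases c)
  obtain ds1 ds2 where ds: "ds = ds1 @ ds2" and f: "list_all2 (maps_cell f) (cells l (a, h / 2)) ds1"
    "list_all2 (maps_cell f) (cells r (a + h / 2, h / 2)) ds2"
    using Node.prems(1) by (auto simp: c list_all2_append1)
  have "list_all2 (maps_cell g) (cells l (a, h / 2)) ds1"
    "list_all2 (maps_cell g) (cells r (a + h / 2, h / 2)) ds2"
    using Node.prems(2) list_all2_lengthD[OF f(1)] by (auto simp: c ds list_all2_append)
  with f Node.IH(1)[of "(a, h / 2)" ds1] Node.IH(2)[of "(a + h / 2, h / 2)" ds2] Node.prems(3)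
  show ?case
    by (cases "t \<le> a + h / 2") (auto simp: c)
qed

definition tail :: "nat \<Rightarrow> cell" where
  "tail i = (1 - 1 / 2 ^ i, 1 / 2 ^ i)"

lemma F_word_single_apply: "t \<in> {0..1} \<Longrightarrow> F.word [i] t = stretch (1 / 2 ^ i) t"
  by (simp only: F_word_Cons_apply F_word_Nil_apply)

lemma rotation_maps_cells:
  "list_all2 (maps_cell (F.word [i]))
    (cells (Node (Node a b) r) (tail i)) (cells (Node a (Node b r)) (tail i))"
proof -
  define e :: real where "e = 1 / 2 ^ i"
  have e: "0 < e" "e \<le> 1" by (auto simp: e_def)
  have x: "F.word [i] t = stretch e t" if "1 - e \<le> t" "t \<le> 1" for t
    using F_word_single_apply[of t i] that e by (simp add: e_def[symmetric])
  have "maps_cell (F.word [i]) (1 - e, e / 2 / 2) (1 - e, e / 2)"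
    "maps_cell (F.word [i]) (1 - e + e / 2 / 2, e / 2 / 2) (1 - e + e / 2, e / 2 / 2)"
    "maps_cell (F.word [i]) (1 - e + e / 2, e / 2) (1 - e + e / 2 + e / 2 / 2, e / 2 / 2)"
    using e by (auto simp: maps_cell_def x stretch_pieces field_simps simp del: F.word_simps)
  then show ?thesis
    by (simp add: tail_def del: F.word_simps flip: e_def) (intro list_all2_appendI maps_cell_cells)
qed

lemma comb_maps_cells:
  "list_all2 (maps_cell (F.word (comb i T))) (cells T (tail i)) (cells (vine (carets T)) (tail i))"
proof (induction i T rule: comb.induct)
  case (1 i)
  define e :: real where "e = 1 / 2 ^ i"
  have "0 < e" "e \<le> 1" by (auto simp: e_def)
  then have "maps_cell (F.word []) (1 - e, e) (1 - e, e)"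
    by (auto simp: maps_cell_def thompson_group_one_apply)
  then show ?case by (simp add: tail_def e_def)
next
  case (2 i r)
  define e :: real where "e = 1 / 2 ^ i"
  have e: "0 < e" "e \<le> 1" by (auto simp: e_def)
  have tail: "tail (Suc i) = (1 - e / 2, e / 2)"
    by (simp add: tail_def e_def)
  have fix_left: "F.word (comb (Suc i) r) t = t" if "1 - e \<le> t" "t \<le> 1 - e / 2" for t
  proof (rule F_word_fixes[of _ "Suc i"])
    show "0 \<le> t" using that e by linarith
    show "t \<le> 1 - 1 / 2 ^ Suc i" using that(2) by (simp add: e_def)
  qed (use comb_ge in blast)
  have "maps_cell (F.word (comb (Suc i) r)) (1 - e, e / 2) (1 - e, e / 2)"
    using e by (auto simp: maps_cell_def fix_left)
  with 2 show ?case
    by (simp add: tail_def[of i] tail flip: e_def)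
next
  case (3 i a b r)
  show ?case
    by (rule list_all2_maps_cell_trans[OF rotation_maps_cells])
      (use 3 in \<open>auto simp: F_word_append_apply add.assoc simp del: F.word_simps\<close>)
qed

text \<open>
  Both sides straighten \<open>T\<close>: the right side directly, the left side by passing to
  \<open>S\<close> first. The two vines have the same number of leaves.
\<close>

lemma subdivision_pair_fraction:
  assumes "f \<in> carrier thompson_group"
    and "list_all2 (maps_cell f) (cells T (0, 1)) (cells S (0, 1))"
  shows "F.word (comb 0 S) \<otimes>\<^bsub>thompson_group\<^esub> f = F.word (comb 0 T)"
proof (rule thompson_group_eqI)
  have tail: "tail 0 = (0, 1)" by (simp add: tail_def)
  have "carets S = carets T"
    using list_all2_lengthD[OF assms(2)] by (simp add: length_cells)
  then have T: "list_all2 (maps_cell (F.word (comb 0 T))) (cells T (0, 1)) (cells (vine (carets S)) (0, 1))"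
    and S: "list_all2 (maps_cell (F.word (comb 0 S))) (cells S (0, 1)) (cells (vine (carets S)) (0, 1))"
    using comb_maps_cells[of 0 T] comb_maps_cells[of 0 S] by (auto simp: tail)
  have "list_all2 (maps_cell (F.word (comb 0 S) \<otimes>\<^bsub>thompson_group\<^esub> f)) (cells T (0, 1)) (cells (vine (carets S)) (0, 1))"
    by (rule list_all2_maps_cell_trans[OF assms(2) S]) (simp add: thompson_group_mult_apply assms(1))
  from maps_cells_agree[OF this T]
  show "(F.word (comb 0 S) \<otimes>\<^bsub>thompson_group\<^esub> f) t = F.word (comb 0 T) t" if "t \<in> {0..1}" for t
    using that by simp
qed (use assms(1) in simp_all)

section \<open>Elements of Thompson's group as pairs of subdivisions\<close>

definition standard_cell :: "cell \<Rightarrow> bool" where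
  "standard_cell c \<longleftrightarrow> (\<exists>n::nat. snd c = 1 / 2 ^ n \<and> fst c * 2 ^ n \<in> \<int>)"

lemma standard_cell_pos: "standard_cell c \<Longrightarrow> 0 < snd c"
  by (auto simp: standard_cell_def)

lemma standard_cell_halves:
  assumes "standard_cell (a, h)"
  shows "standard_cell (a, h / 2)" "standard_cell (a + h / 2, h / 2)"
proof -
  obtain n :: nat where h: "h = 1 / 2 ^ n" and a: "a * 2 ^ n \<in> \<int>"
    using assms by (auto simp: standard_cell_def)
  have "a * 2 ^ Suc n = 2 * (a * 2 ^ n)" "(a + h / 2) * 2 ^ Suc n = 2 * (a * 2 ^ n) + 1"
    by (auto simp: h field_simps)
  with a have "a * 2 ^ Suc n \<in> \<int>" "(a + h / 2) * 2 ^ Suc n \<in> \<int>"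
    by (metis Ints_add Ints_mult Ints_numeral Ints_1)+
  moreover have "h / 2 = 1 / 2 ^ Suc n" by (simp add: h)
  ultimately show "standard_cell (a, h / 2)" "standard_cell (a + h / 2, h / 2)"
    unfolding standard_cell_def by (metis fst_conv snd_conv)+
qed

fun chain :: "real \<Rightarrow> cell list \<Rightarrow> real \<Rightarrow> bool" where
  "chain a [] b \<longleftrightarrow> a = b"
| "chain a (c # cs) b \<longleftrightarrow> fst c = a \<and> chain (a + snd c) cs b"

lemma chain_append: "chain a (cs @ ds) b \<longleftrightarrow> (\<exists>m. chain a cs m \<and> chain m ds b)"
  by (induction cs arbitrary: a) auto

lemma chain_less:
  "chain a cs b \<Longrightarrow> \<forall>c\<in>set cs. 0 < snd c \<Longrightarrow> cs \<noteq> [] \<Longrightarrow> a < b"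
proof (induction cs arbitrary: a)
  case (Cons c cs)
  then have c: "0 < snd c" and ch: "chain (a + snd c) cs b" by auto
  show ?case
  proof (cases "cs = []")
    case False
    then have "a + snd c < b"
      using Cons.IH[OF ch] Cons.prems by simp
    with c show ?thesis by linarith
  qed (use c ch in simp)
qed simp

lemma chain_split:
  assumes "chain a cs b" "\<forall>c\<in>set cs. 0 < snd c" "a \<le> m" "m \<le> b"
    and "\<forall>c\<in>set cs. \<not> (fst c < m \<and> m < fst c + snd c)"
  shows "\<exists>cs1 cs2. cs = cs1 @ cs2 \<and> chain a cs1 m \<and> chain m cs2 b"
  using assms
proof (induction cs arbitrary: a)
  case Nil
  then show ?case by auto
next
  case (Cons c cs)
  show ?case
  proof (cases "m = a")
    case True
    then show ?thesis using Cons.prems by (intro exI[of _ "[]"] exI[of _ "c # cs"]) auto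
  next
    case False
    then have "a + snd c \<le> m"
      using Cons.prems by auto
    then obtain cs1 cs2 where "cs = cs1 @ cs2" "chain (a + snd c) cs1 m" "chain m cs2 b"
      using Cons.IH[of "a + snd c"] Cons.prems by auto
    then show ?thesis
      using Cons.prems by (intro exI[of _ "c # cs1"] exI[of _ cs2]) auto
  qed
qed

text \<open>
  A number with denominator \<open>2\<^sup>m\<close> is never interior to a standard cell of
  length \<open>1/2\<^sup>m\<close>, and the midpoint of a cell of length \<open>h\<close> is
  such a number as soon as \<open>1/2\<^sup>m < h\<close>.
\<close>

lemma standard_cell_across_midpoint:
  assumes "standard_cell (a, h)" "standard_cell c" "fst c < a + h / 2" "a + h / 2 < fst c + snd c"
  shows "h \<le> snd c"
proof (rule ccontr)
  assume less: "\<not> h \<le> snd c"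
  obtain n :: nat where h: "h = 1 / 2 ^ n" and a: "a * 2 ^ n \<in> \<int>"
    using assms(1) by (auto simp: standard_cell_def)
  obtain m :: nat where m: "snd c = 1 / 2 ^ m" and c: "fst c * 2 ^ m \<in> \<int>"
    using assms(2) by (auto simp: standard_cell_def)
  have "(2::real) ^ n < 2 ^ m"
    using less by (simp add: h m field_simps)
  then have "n < m"
    by simp
  then obtain k where k: "m = Suc (n + k)"
    using less_imp_Suc_add by blast
  have "(a + h / 2) * 2 ^ m = 2 ^ k * (2 * (a * 2 ^ n) + 1)"
    by (simp add: h k power_add field_simps)
  also have "\<dots> \<in> \<int>"
    by (intro Ints_mult[of "2 ^ k"] Ints_add[of "2 * (a * 2 ^ n)"] Ints_mult[of 2] a) simp_all
  finally obtain i where i: "(a + h / 2) * 2 ^ m = of_int i"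
    by (auto elim: Ints_cases)
  obtain j where j: "fst c * 2 ^ m = of_int j"
    using c by (auto elim: Ints_cases)
  have "fst c * 2 ^ m < (a + h / 2) * 2 ^ m" "(a + h / 2) * 2 ^ m < (fst c + snd c) * 2 ^ m"
    using assms(3,4) by (intro mult_strict_right_mono; simp)+
  moreover have "(fst c + snd c) * 2 ^ m = of_int (j + 1)"
    by (simp add: distrib_right j m)
  ultimately show False
    unfolding i j of_int_less_iff by simp
qed

text \<open>
  If no cell of the chain contains the midpoint in its interior, then the chain splits at the
  midpoint and the halves are treated separately. Otherwise that cell is too long to leave room
  for any other.
\<close>

lemma standard_chain_is_subdivision:
  assumes "standard_cell (a, h)" "chain a cs (a + h)" "\<forall>c\<in>set cs. standard_cell c"
  shows "\<exists>T. cells T (a, h) = cs"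
  using assms
proof (induction "length cs" arbitrary: a h cs rule: less_induct)
  case less
  have pos: "\<forall>c\<in>set cs. 0 < snd c" "0 < h"
    using less.prems standard_cell_pos by auto
  show ?case
  proof (cases "\<exists>c\<in>set cs. fst c < a + h / 2 \<and> a + h / 2 < fst c + snd c")
    case True
    then obtain c where c: "c \<in> set cs" "fst c < a + h / 2" "a + h / 2 < fst c + snd c" by blast
    then have le: "h \<le> snd c"
      using standard_cell_across_midpoint less.prems by blast
    obtain xs ys where cs: "cs = xs @ c # ys"
      using c(1) by (auto simp: in_set_conv_decomp)
    then have ch: "chain a xs (fst c)" "chain (fst c + snd c) ys (a + h)"
      using less.prems(2) by (auto simp: chain_append)
    have "xs \<noteq> [] \<Longrightarrow> a < fst c" "ys \<noteq> [] \<Longrightarrow> fst c + snd c < a + h"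
      using chain_less[OF ch(1)] chain_less[OF ch(2)] pos cs by auto
    with ch le have "xs = []" "ys = []"
      by (cases "xs = []"; cases "ys = []"; simp)+
    with ch cs have "cs = [(a, h)]"
      by (cases c) auto
    then show ?thesis
      by (intro exI[of _ Leaf]) simp
  next
    case False
    then obtain cs1 cs2 where cs: "cs = cs1 @ cs2"
      and ch: "chain a cs1 (a + h / 2)" "chain (a + h / 2) cs2 (a + h)"
      using chain_split[OF less.prems(2) pos(1), of "a + h / 2"] pos(2) by auto
    have ne: "cs1 \<noteq> []" "cs2 \<noteq> []"
      using ch pos(2) by auto
    obtain T1 where "cells T1 (a, h / 2) = cs1"
      using less.hyps[of cs1 a "h / 2"] standard_cell_halves[OF less.prems(1)] ne ch less.prems(3) cs
      by auto
    moreover obtain T2 where "cells T2 (a + h / 2, h / 2) = cs2"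
      using less.hyps[of cs2 "a + h / 2" "h / 2"] standard_cell_halves[OF less.prems(1)] ne ch less.prems(3) cs
      by (auto simp: add.assoc)
    ultimately show ?thesis
      by (intro exI[of _ "Node T1 T2"]) (simp add: cs)
  qed
qed

lemma chain_uniform: "chain a (map (\<lambda>i. (a + real i * h, h)) [0..<m]) (a + real m * h)"
  by (induction m) (auto simp: chain_append algebra_simps)

text \<open>
  Between breakpoints the map is affine with dyadic data, so that a sufficiently fine uniform
  grid is mapped to standard cells. Chains over adjacent intervals are concatenated, by
  induction on the number of breakpoints inside the interval.
\<close>

lemma standard_chains:
  assumes f: "f \<in> carrier thompson_group"
    and "0 \<le> a" "a \<le> b" "b \<le> 1" "a \<in> dyadic" "b \<in> dyadic"
  shows "\<exists>cs ds. chain a cs b \<and> chain (f a) ds (f b) \<and> (\<forall>c\<in>set cs. standard_cell c) \<and>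
    (\<forall>d\<in>set ds. standard_cell d) \<and> list_all2 (maps_cell f) cs ds"
proof -
  obtain B where B: "finite B" "B \<subseteq> dyadic"
    and aff: "\<forall>a b. 0 \<le> a \<and> a < b \<and> b \<le> 1 \<and> {a<..<b} \<inter> B = {} \<longrightarrow>
        (\<exists>(k :: int) c. \<forall>t\<in>{a..b}. f t = 2 powi k * t + c)"
    by (rule thompson_group_pieces[OF f])
  show ?thesis
    using assms(2-)
  proof (induction "card ({a<..<b} \<inter> B)" arbitrary: a b rule: less_induct)
    case less
    consider "a = b" | "a < b" "{a<..<b} \<inter> B = {}" | p where "p \<in> {a<..<b} \<inter> B"
      using less.prems by fastforce
    then show ?case
    proof cases
      case 1
      then show ?thesis by (intro exI[of _ "[]"]) simp
    next
      case 2
      then obtain k c where kc: "\<forall>t\<in>{a..b}. f t = 2 powi k * t + c"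
        using aff less.prems by blast
      have slope: "f t = f a + 2 powi k * (t - a)" if "t \<in> {a..b}" for t
        using kc that 2 by (simp add: algebra_simps)
      have "f a \<in> dyadic"
        using thompson_group_dyadic_iff[OF f, of a] less.prems by simp
      then have "\<forall>\<^sub>F n in sequentially. f a / 2 powi k * 2 ^ n \<in> \<int>"
        using dyadic_unscale dyadic_iff_eventually by blast
      moreover have "\<forall>\<^sub>F n in sequentially. a * 2 ^ n \<in> \<int>" "\<forall>\<^sub>F n in sequentially. b * 2 ^ n \<in> \<int>"
        using less.prems dyadic_iff_eventually by auto
      ultimately have "\<forall>\<^sub>F n in sequentially. f a / 2 powi k * 2 ^ n \<in> \<int> \<and> a * 2 ^ n \<in> \<int> \<and>
          b * 2 ^ n \<in> \<int> \<and> nat k \<le> n"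
        by (intro eventually_conj eventually_ge_at_top)
      then obtain n where n: "f a / 2 powi k * 2 ^ n \<in> \<int>" "a * 2 ^ n \<in> \<int>" "b * 2 ^ n \<in> \<int>" "nat k \<le> n"
        using eventually_sequentially by auto
      \<comment> \<open>The grid has mesh \<open>1/2\<^sup>n\<close>; the first condition on \<open>n\<close> puts the image points at multiples of the image
        mesh \<open>1/2\<^sup>l\<close>, and the last one makes \<open>l\<close> non-negative.\<close>
      define h :: real where "h = 1 / 2 ^ n"
      define l :: nat where "l = nat (int n - k)"
      have l: "int l = int n - k" using n(4) by (simp add: l_def)
      have "2 powi k * h = 2 powi (k - int n)"
        by (simp add: h_def power_int_diff)
      also have "k - int n = - int l" using l by simp
      finally have kh: "2 powi k * h = 1 / 2 ^ l"
        by (simp add: power_int_minus field_simps)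
      then have kl: "2 ^ l * 2 powi k = (2::real) ^ n"
        by (simp add: h_def field_simps)
      have "(b - a) * 2 ^ n \<in> \<int>"
        using n by (simp add: left_diff_distrib)
      moreover have "(b - a) * 2 ^ n > 0" using 2 by simp
      ultimately obtain m :: nat where m: "(b - a) * 2 ^ n = real m"
        by (metis Ints_cases of_int_0_less_iff of_int_of_nat_eq zero_less_imp_eq_int)
      have b: "b = a + real m * h"
        using m by (simp add: h_def field_simps)
      have h: "0 < h" by (simp add: h_def)
      let ?cs = "map (\<lambda>i. (a + real i * h, h)) [0..<m]"
      let ?ds = "map (\<lambda>i. (f a + real i * (2 powi k * h), 2 powi k * h)) [0..<m]"
      have "chain a ?cs b"
        unfolding b by (rule chain_uniform)
      moreover have "f b = f a + real m * (2 powi k * h)"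
        using slope[of b] 2 by (simp add: b)
      then have "chain (f a) ?ds (f b)"
        using chain_uniform[of "f a" "2 powi k * h" m] by simp
      moreover have "\<forall>c\<in>set ?cs. standard_cell c"
        using n(2) by (auto simp: standard_cell_def h_def distrib_right intro!: exI[of _ n] Ints_add)
      moreover have "(f a + real i * (2 powi k * h)) * 2 ^ l \<in> \<int>" for i
      proof -
        have "(f a + real i * (2 powi k * h)) * 2 ^ l = f a * 2 ^ l + real i"
          unfolding kh by (simp add: distrib_right)
        also have "f a * 2 ^ l = f a / 2 powi k * 2 ^ n"
          unfolding kl[symmetric] by simp
        finally show ?thesis using n(1) by simp
      qed
      then have "\<forall>d\<in>set ?ds. standard_cell d"
        using kh by (auto simp: standard_cell_def)
      moreover have "maps_cell f (a + real i * h, h) (f a + real i * (2 powi k * h), 2 powi k * h)"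
        if "i < m" for i
      proof -
        have "real i + 1 \<le> real m" using that by simp
        then have "(real i + 1) * h \<le> real m * h"
          using h by (intro mult_right_mono) auto
        then have "a + real i * h + h \<le> b"
          by (simp add: b distrib_right)
        moreover have "0 \<le> real i * h" using h by simp
        moreover have "f t = f a + real i * (2 powi k * h) + (t - (a + real i * h)) * (2 powi k * h / h)"
          if "a + real i * h \<le> t" "t \<le> a + real i * h + h" for t
        proof -
          have "0 \<le> real i * h" using h by simp
          with that calculation have "t \<in> {a..b}" unfolding atLeastAtMost_iff by linarith
          from slope[OF this] show ?thesis
            using h by (simp add: algebra_simps)
        qed
        ultimately show ?thesis
          using less.prems(1,3) h unfolding maps_cell_def by simp
      qed
      then have "list_all2 (maps_cell f) ?cs ?ds"
        by (auto simp: list_all2_conv_all_nth)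
      ultimately show ?thesis by blast
    next
      case 3
      have p: "a < p" "p < b" "p \<in> dyadic" using 3 B by auto
      have "card ({a<..<p} \<inter> B) < card ({a<..<b} \<inter> B)" "card ({p<..<b} \<inter> B) < card ({a<..<b} \<inter> B)"
        using 3 B(1) p by (intro psubset_card_mono; auto)+
      obtain cs ds where
        "chain a cs p" "chain (f a) ds (f p)" "\<forall>c\<in>set cs. standard_cell c" "\<forall>d\<in>set ds. standard_cell d"
        "list_all2 (maps_cell f) cs ds"
        using less.hyps[OF \<open>card ({a<..<p} \<inter> B) < _\<close>] less.prems p by auto
      moreover obtain cs' ds' where
        "chain p cs' b" "chain (f p) ds' (f b)" "\<forall>c\<in>set cs'. standard_cell c" "\<forall>d\<in>set ds'. standard_cell d"
        "list_all2 (maps_cell f) cs' ds'"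
        using less.hyps[OF \<open>card ({p<..<b} \<inter> B) < _\<close>] less.prems p by auto
      ultimately show ?thesis
        by (intro exI[of _ "cs @ cs'"] exI[of _ "ds @ ds'"])
          (auto simp: chain_append intro: list_all2_appendI)
    qed
  qed
qed

text \<open>
  The interval from \<open>0\<close> to \<open>1/2\<^sup>q\<close> is the whole unit interval
  for \<open>q = 0\<close>. The case \<open>q = 1\<close> concerns elements that fix the
  midpoint: they can be described by subdivisions of the left half.
\<close>

lemma subdivision_pair_exists:
  assumes f: "f \<in> carrier thompson_group" and z: "f (1 / 2 ^ q) = 1 / 2 ^ q"
  shows "\<exists>T S. list_all2 (maps_cell f) (cells T (0, 1 / 2 ^ q)) (cells S (0, 1 / 2 ^ q))"
proof -
  have "(0::real) \<in> dyadic" "(1::real) / 2 ^ q \<in> dyadic"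
    using dyadic_Ints[of 0] dyadic_div_power[OF dyadic_Ints[of 1]] by auto
  moreover have "(1::real) / 2 ^ q \<le> 1" by simp
  moreover have "f 0 = 0" using f by (simp add: thompson_group_carrier)
  ultimately obtain cs ds where "chain 0 cs (1 / 2 ^ q)" "chain 0 ds (1 / 2 ^ q)"
    "\<forall>c\<in>set cs. standard_cell c" "\<forall>d\<in>set ds. standard_cell d" "list_all2 (maps_cell f) cs ds"
    using standard_chains[OF f, of 0 "1 / 2 ^ q"] z by auto
  moreover have "standard_cell (0, 1 / 2 ^ q)"
    by (auto simp: standard_cell_def)
  ultimately show ?thesis
    using standard_chain_is_subdivision[of 0 "1 / 2 ^ q"] by (metis add_0)
qed

section \<open>Centralizers and conjugacy of the generators\<close>

lemma thompson_x_gt: "1 - 1 / 2 ^ i < t \<Longrightarrow> t < 1 \<Longrightarrow> t < thompson_x i t"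
proof -
  assume t: "1 - 1 / 2 ^ i < t" "t < 1"
  have "(1::real) / 2 ^ i \<le> 1" by simp
  then have "t \<in> {0..1}" using t unfolding atLeastAtMost_iff by linarith
  then show ?thesis
    using t stretch_gt[of "1 / 2 ^ i" t] by (simp add: thompson_x_stretch)
qed

lemma thompson_x_fixed:
  assumes "0 \<le> t" "t \<le> 1 - 1 / 2 ^ i"
  shows "thompson_x i t = t"
proof -
  have "(0::real) \<le> 1 / 2 ^ i" by simp
  then have "t \<in> {0..1}" using assms unfolding atLeastAtMost_iff by linarith
  then show ?thesis
    using assms stretch_pieces(1)[of "1 / 2 ^ i" t] by (simp add: thompson_x_stretch)
qed

lemma thompson_group_surj:
  assumes "f \<in> carrier thompson_group" "y \<in> {0..1}"
  shows "\<exists>t\<in>{0..1}. f t = y"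
proof -
  have "f ` {0..1} = {0..1}"
    using assms(1) strict_monotone_image(1)[of f 0 1] by (simp add: thompson_group_carrier)
  with assms(2) have "y \<in> f ` {0..1}" by (simp only:)
  then show ?thesis by (elim imageE) (rule bexI, rule sym)
qed

text \<open>
  If \<open>f\<close> and \<open>g\<close> commute with \<open>x\<^sub>i\<close> and agree from
  \<open>a\<close> to \<open>s\<close>, then they agree from \<open>a\<close> to
  \<open>x\<^sub>i s\<close>. As \<open>x\<^sub>i\<close> moves every point strictly between
  \<open>a\<close> and \<open>1\<close> to the right, agreement near \<open>a\<close> extends up
  to \<open>1\<close>.
\<close>

lemma commuting_germ_agree:
  assumes f: "f \<in> carrier thompson_group" "g \<in> carrier thompson_group"
    and comm: "f \<otimes>\<^bsub>thompson_group\<^esub> thompson_x i = thompson_x i \<otimes>\<^bsub>thompson_group\<^esub> f"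
      "g \<otimes>\<^bsub>thompson_group\<^esub> thompson_x i = thompson_x i \<otimes>\<^bsub>thompson_group\<^esub> g"
    and a: "a = 1 - 1 / 2 ^ i"
    and germ: "a < b" "\<And>t. t \<in> {a..b} \<Longrightarrow> f t = g t"
    and t: "t \<in> {a..1}"
  shows "f t = g t"
proof -
  let ?x = "thompson_x i"
  have a01: "0 \<le> a" "a < 1" by (simp_all add: a)
  have xa: "?x a = a" using thompson_x_fixed[of a i] a01 a by simp
  have fx: "f (?x s) = ?x (f s)" "g (?x s) = ?x (g s)" if "s \<in> {0..1}" for s
    using comm f that by (metis thompson_group_mult_apply thompson_x_closed)+
  define S where "S = {s \<in> {a..1}. \<forall>t\<in>{a..s}. f t = g t}"
  have step: "?x s \<in> S" if s: "s \<in> S" for s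
  proof -
    have s01: "a \<le> s" "s \<le> 1" using s by (auto simp: S_def)
    have img: "?x ` {a..s} = {a..?x s}"
      using strict_monotone_image(1)[of ?x a s] thompson_x_closed[of i] a01 s01 xa
      by (simp add: thompson_group_carrier)
    have "f u = g u" if u: "u \<in> {a..?x s}" for u
    proof -
      obtain v where v: "v \<in> {a..s}" "u = ?x v" using u img by blast
      then have "f v = g v" using s by (auto simp: S_def)
      then show ?thesis using fx[of v] v a01 s01 by simp
    qed
    moreover have "?x s \<in> {a..1}"
    proof -
      have "?x s \<in> ?x ` {a..s}" using s01 by simp
      then show ?thesis
        using img thompson_group_maps[OF thompson_x_closed, of s i] s01 a01 by auto
    qed
    ultimately show ?thesis by (auto simp: S_def)
  qed
  define b' where "b' = min b 1"
  have b': "b' \<in> S" "a < b'" using germ a01 by (auto simp: S_def b'_def)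
  have bdd: "bdd_above S" by (rule bdd_aboveI[of _ 1]) (auto simp: S_def)
  define \<sigma> where "\<sigma> = Sup S"
  have le: "s \<le> \<sigma>" if "s \<in> S" for s
    unfolding \<sigma>_def using bdd that by (rule cSup_upper[rotated])
  have \<sigma>: "a < \<sigma>" "\<sigma> \<le> 1"
    using le[OF b'(1)] b' by (auto simp: \<sigma>_def S_def intro!: cSup_least)
  have "\<sigma> = 1"
  proof (rule ccontr)
    assume "\<sigma> \<noteq> 1"
    with \<sigma> have \<sigma>1: "\<sigma> < 1" by simp
    \<comment> \<open>If \<open>\<sigma>\<close> were below \<open>1\<close>, its preimage under \<open>x\<^sub>i\<close> would be below \<open>\<sigma>\<close>, and a point of agreement
      between the two would be moved beyond \<open>\<sigma>\<close>.\<close>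
    have "\<sigma> \<in> {0..1}" using \<sigma> a01 by simp
    then obtain u where u: "u \<in> {0..1}" "?x u = \<sigma>"
      using thompson_group_surj[OF thompson_x_closed] by blast
    have "a < u"
      using u \<sigma> xa thompson_group_less_iff(1)[OF thompson_x_closed, of a u i] a01 by simp
    moreover have "u < 1"
      using u \<sigma>1 thompson_group_less_iff(1)[OF thompson_x_closed, of u 1 i] thompson_x_closed[of i]
      by (simp add: thompson_group_carrier)
    ultimately have "u < \<sigma>"
      using thompson_x_gt[of i u] u a by simp
    then obtain s where s: "s \<in> S" "u < s"
      using less_cSup_iff[OF _ bdd] b'(1) unfolding \<sigma>_def by blast
    then have "\<sigma> < ?x s"
      using u thompson_group_less_iff(1)[OF thompson_x_closed, of u s i] by (auto simp: S_def)
    with le[OF step[OF s(1)]] show False by simp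
  qed
  show ?thesis
  proof (cases "t = 1")
    case True
    then show ?thesis using f by (simp add: thompson_group_carrier)
  next
    case False
    then have "t < \<sigma>" using t \<open>\<sigma> = 1\<close> by simp
    then obtain s where "s \<in> S" "t < s"
      using less_cSup_iff[OF _ bdd] b'(1) unfolding \<sigma>_def by blast
    then show ?thesis using t by (auto simp: S_def)
  qed
qed

text \<open>
  Such an \<open>f\<close> preserves the fixed points of \<open>x\<^sub>i\<close>, which are
  \<open>1\<close> and the points up to \<open>a\<close>.
\<close>

lemma commuting_fixes:
  assumes f: "f \<in> carrier thompson_group"
    and comm: "f \<otimes>\<^bsub>thompson_group\<^esub> thompson_x i = thompson_x i \<otimes>\<^bsub>thompson_group\<^esub> f"
    and a: "a = 1 - 1 / 2 ^ i"
  shows "f a = a"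
proof (rule ccontr)
  let ?x = "thompson_x i"
  have a01: "0 \<le> a" "a < 1" by (simp_all add: a)
  have fixed: "?x s = s" if "0 \<le> s" "s \<le> a" for s using thompson_x_fixed that a by simp
  have moved: "?x s \<noteq> s" if "a < s" "s < 1" for s using thompson_x_gt[of i s] that a by simp
  have fx: "f (?x s) = ?x (f s)" if "s \<in> {0..1}" for s
    using comm f that by (metis thompson_group_mult_apply thompson_x_closed)
  have f1: "f 1 = 1" using f by (simp add: thompson_group_carrier)
  assume "f a \<noteq> a"
  then consider "a < f a" | "f a < a" by linarith
  then show False
  proof cases
    case 1
    have "f a < 1" using thompson_group_less_iff(1)[OF f, of a 1] a01 f1 by simp
    then show False using fx[of a] fixed[of a] moved[of "f a"] 1 a01 by simp
  next
    case 2
    obtain s where s: "s \<in> {0..1}" "f s = a"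
      using thompson_group_surj[OF f, of a] a01 by auto
    have "a < s" using thompson_group_less_iff(1)[OF f, of a s] s 2 a01 by simp
    moreover have "s < 1" using thompson_group_less_iff(1)[OF f, of s 1] s f1 a01 by simp
    moreover have "f (?x s) = f s" using fx[OF s(1)] s fixed[of a] a01 by simp
    then have "?x s = s"
      using thompson_group_less_iff(3)[OF f] s thompson_group_maps[OF thompson_x_closed s(1)] by blast
    ultimately show False using moved by blast
  qed
qed

text \<open>
  To the right of the left end of the support, \<open>f\<close> has a slope
  \<open>2\<^sup>k\<close> with an integer \<open>k\<close>, and \<open>x\<^sub>i\<close> has
  slope 2 there. The integer power is expressed by two natural exponents \<open>m\<close> and
  \<open>n\<close> with \<open>k + m = n\<close>.
\<close>

lemma commuting_is_power:
  assumes f: "f \<in> carrier thompson_group"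
    and comm: "f \<otimes>\<^bsub>thompson_group\<^esub> thompson_x i = thompson_x i \<otimes>\<^bsub>thompson_group\<^esub> f"
  shows "\<exists>m n. \<forall>t\<in>{1 - 1 / 2 ^ i..1}.
    (f \<otimes>\<^bsub>thompson_group\<^esub> F.word (replicate m i)) t = F.word (replicate n i) t"
proof -
  define e :: real where "e = 1 / 2 ^ i"
  define a where "a = 1 - e"
  have e: "0 < e" "e \<le> 1" by (auto simp: e_def)
  have fa: "f a = a" using commuting_fixes[OF f comm] by (simp add: a_def e_def)
  obtain B where B: "finite B"
    and aff: "\<forall>a b. 0 \<le> a \<and> a < b \<and> b \<le> 1 \<and> {a<..<b} \<inter> B = {} \<longrightarrow>
        (\<exists>(k :: int) c. \<forall>t\<in>{a..b}. f t = 2 powi k * t + c)"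
    by (rule thompson_group_pieces[OF f])
  define b where "b = Min (insert 1 (B \<inter> {a<..}))"
  have "b \<in> insert 1 (B \<inter> {a<..})"
    unfolding b_def using B by (intro Min_in) auto
  moreover have le: "b \<le> s" if "s \<in> insert 1 (B \<inter> {a<..})" for s
    unfolding b_def using B that by (intro Min_le) auto
  ultimately have b: "a < b" "b \<le> 1"
    using e by (auto simp: a_def)
  have "{a<..<b} \<inter> B = {}"
  proof (intro equals0I)
    fix s assume "s \<in> {a<..<b} \<inter> B"
    then show False using le[of s] by simp
  qed
  then obtain k c where "\<forall>t\<in>{a..b}. f t = 2 powi k * t + c"
    using aff[rule_format, of a b] e b by (auto simp: a_def)
  then have slope: "f t = a + 2 powi k * (t - a)" if "t \<in> {a..b}" for t
    using that b fa by (auto simp: algebra_simps)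
  define m where "m = nat (- k)"
  define n where "n = nat k"
  have "2 powi k * 2 ^ m = (2::real) ^ n"
    by (simp add: m_def n_def power_int_def flip: power_mult_distrib)
  let ?f = "f \<otimes>\<^bsub>thompson_group\<^esub> F.word (replicate m i)" and ?g = "F.word (replicate n i)"
  have comm_power: "F.word (replicate j i) \<otimes>\<^bsub>thompson_group\<^esub> thompson_x i =
      thompson_x i \<otimes>\<^bsub>thompson_group\<^esub> F.word (replicate j i)" for j
    by (induction j) (simp_all add: F.m_assoc)
  \<comment> \<open>Within distance \<open>\<delta>\<close> of \<open>a\<close>, up to \<open>m + n\<close> doublings stay inside both the doubling zone of the generator
    and the first affine piece of \<open>f\<close>.\<close>
  define \<delta> where "\<delta> = min (e / 2) (b - a) / 2 ^ (m + n)"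
  have \<delta>: "0 < \<delta>" using e b by (simp add: \<delta>_def)
  have germ: "?f t = ?g t" if t: "t \<in> {a..a + \<delta>}" for t
  proof -
    define s where "s = t - a"
    have s: "0 \<le> s" "s \<le> \<delta>" using t by (auto simp: s_def)
    have bound: "2 ^ j * s \<le> min (e / 2) (b - a)" if "j \<le> m + n" for j
    proof -
      have "2 ^ j * s \<le> 2 ^ (m + n) * \<delta>"
        using that s by (intro mult_mono power_increasing) auto
      then show ?thesis by (simp add: \<delta>_def)
    qed
    have "s \<le> e" using bound[of 0] e by simp
    then have t01: "t \<in> {0..1}" using s e by (simp add: a_def s_def)
    have t_eq: "t = 1 - 1 / 2 ^ i + s" by (simp add: s_def a_def e_def)
    have wm: "F.word (replicate m i) t = a + 2 ^ m * s" and wn: "?g t = a + 2 ^ n * s"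
      using F_word_replicate[of s m i] F_word_replicate[of s n i] bound[of m] bound[of n] s(1)
      unfolding t_eq by (simp_all add: a_def e_def)
    have "f (a + 2 ^ m * s) = a + 2 powi k * (2 ^ m * s)"
      using slope[of "a + 2 ^ m * s"] bound[of m] s(1) by simp
    also have "2 powi k * (2 ^ m * s) = 2 ^ n * s"
      using \<open>2 powi k * 2 ^ m = 2 ^ n\<close> by (simp flip: mult.assoc)
    finally show ?thesis
      using thompson_group_mult_apply[OF f F.word_closed t01] wm wn by simp
  qed
  have "?f t = ?g t" if "t \<in> {a..1}" for t
  proof (rule commuting_germ_agree[of ?f ?g i a "a + \<delta>"])
    show "?f \<otimes>\<^bsub>thompson_group\<^esub> thompson_x i = thompson_x i \<otimes>\<^bsub>thompson_group\<^esub> ?f"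
      using f by (simp add: F.m_assoc comm_power) (simp add: comm flip: F.m_assoc)
  qed (use f germ \<delta> that comm_power in \<open>simp_all add: a_def e_def\<close>)
  then show ?thesis unfolding a_def e_def by (intro exI[of _ m] exI[of _ n] ballI)
qed

text \<open>
  The point \<open>1/2\<close> is fixed by the second generator, so its preimage under
  \<open>f\<close> would be a fixed point of the first one in the open unit interval.
\<close>

lemma thompson_x_not_conjugate:
  assumes f: "f \<in> carrier thompson_group"
  shows "f \<otimes>\<^bsub>thompson_group\<^esub> thompson_x 0 \<noteq> thompson_x 1 \<otimes>\<^bsub>thompson_group\<^esub> f"
proof
  assume comm: "f \<otimes>\<^bsub>thompson_group\<^esub> thompson_x 0 = thompson_x 1 \<otimes>\<^bsub>thompson_group\<^esub> f"
  obtain s where s: "s \<in> {0..1}" "f s = 1 / 2"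
    using thompson_group_surj[OF f, of "1 / 2"] by auto
  have "f (thompson_x 0 s) = thompson_x 1 (f s)"
    using comm f s(1) by (metis thompson_group_mult_apply thompson_x_closed)
  also have "\<dots> = f s"
    unfolding s(2) by (rule thompson_x_fixed) simp_all
  finally have "thompson_x 0 s = s"
    using thompson_group_less_iff(3)[OF f] s thompson_group_maps[OF thompson_x_closed s(1)] by blast
  moreover have "f 0 = 0" "f 1 = 1" using f by (auto simp: thompson_group_carrier)
  then have "s \<noteq> 0" "s \<noteq> 1" using s(2) by auto
  ultimately show False
    using thompson_x_gt[of 0 s] s by simp
qed

section \<open>Thompson's quandle and its enveloping group\<close>

lemma (in group) inv_mult_one_imp_eq:
  assumes "a \<in> carrier G" "b \<in> carrier G" "inv a \<otimes> b = \<one>"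
  shows "a = b"
  using assms inv_equality[of "inv a" b] by (metis inv_closed inv_inv)

interpretation P: quandle thompson_quandle
  unfolding thompson_quandle_def by (rule quandle_presented_quandle)

interpretation GrP: group "Gr thompson_quandle"
  by (rule P.group_Gr)

lemma thompson_p_closed [simp]: "thompson_p j \<in> carrier thompson_quandle"
  by (simp add: thompson_p_def thompson_quandle_def presented_quandle_def)

lemma qop_thompson_p: "j < k \<Longrightarrow> qop thompson_quandle (thompson_p j) (thompson_p k) = thompson_p (Suc k)"
  by (auto simp: thompson_p_def thompson_quandle_def qop_qclass qclass_eq_iff thompson_relations_def
      intro!: qeq_rel)

lemma thompson_quandle_induct [consumes 1, case_names generator op inv_op]:
  assumes "q \<in> carrier thompson_quandle"
    and "\<And>j. Q (thompson_p j)"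
    and "\<And>x y. x \<in> carrier thompson_quandle \<Longrightarrow> y \<in> carrier thompson_quandle \<Longrightarrow>
      Q x \<Longrightarrow> Q y \<Longrightarrow> Q (qop thompson_quandle x y)"
    and "\<And>x y. x \<in> carrier thompson_quandle \<Longrightarrow> y \<in> carrier thompson_quandle \<Longrightarrow>
      Q x \<Longrightarrow> Q (qop thompson_quandle x y) \<Longrightarrow> Q y"
  shows "Q q"
proof -
  let ?c = "qclass thompson_relations"
  obtain s where q: "q = ?c s"
    using assms(1) by (auto simp: thompson_quandle_def presented_quandle_def)
  have carr: "?c s \<in> carrier thompson_quandle" for s
    by (simp add: thompson_quandle_def presented_quandle_def)
  have op: "qop thompson_quandle (?c s) (?c t) = ?c (QOp s t)" for s t
    by (simp add: thompson_quandle_def qop_qclass)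
  have "Q (?c s)"
  proof (induction s)
    case (QGen j)
    then show ?case using assms(2)[of j] by (simp add: thompson_p_def)
  next
    case (QOp s t)
    then show ?case using assms(3)[of "?c s" "?c t"] carr by (simp add: op)
  next
    case (QInv s t)
    have "qop thompson_quandle (?c s) (?c (QInv s t)) = ?c t"
      by (simp add: op qclass_eq_iff qeq_QOp_QInv)
    then show ?case using assms(4)[of "?c s" "?c (QInv s t)"] QInv carr by simp
  qed
  then show ?thesis by (simp add: q)
qed

interpretation GrP: thompson_family "Gr thompson_quandle" "\<lambda>j. canonical thompson_quandle (thompson_p j)"
proof
  fix j k :: nat assume "j < k"
  then show "canonical thompson_quandle (thompson_p j) \<otimes>\<^bsub>Gr thompson_quandle\<^esub> canonical thompson_quandle (thompson_p k) =
      canonical thompson_quandle (thompson_p (Suc k)) \<otimes>\<^bsub>Gr thompson_quandle\<^esub> canonical thompson_quandle (thompson_p j)"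
    by (simp add: P.canonical_qop GrP.m_assoc flip: qop_thompson_p[of j k])
qed simp

lemma Gr_thompson_fraction:
  assumes g: "g \<in> carrier (Gr thompson_quandle)"
  shows "\<exists>u v. g = inv\<^bsub>Gr thompson_quandle\<^esub> (GrP.word v) \<otimes>\<^bsub>Gr thompson_quandle\<^esub> GrP.word u"
proof -
  let ?G = "Gr thompson_quandle"
  define H where "H = {inv\<^bsub>?G\<^esub> (GrP.word v) \<otimes>\<^bsub>?G\<^esub> GrP.word u | u v. True}"
  have H: "subgroup H ?G"
    unfolding H_def by (rule GrP.fractions_subgroup)
  have gen: "canonical thompson_quandle q \<in> H" if "q \<in> carrier thompson_quandle" for q
    using that
  proof (induction rule: thompson_quandle_induct)
    case (generator j)
    have "canonical thompson_quandle (thompson_p j) = inv\<^bsub>?G\<^esub> (GrP.word []) \<otimes>\<^bsub>?G\<^esub> GrP.word [j]"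
      by simp
    then show ?case unfolding H_def by blast
  next
    case (op x y)
    then show ?case
      using H by (simp add: P.canonical_qop subgroup.m_closed subgroup.m_inv_closed)
  next
    case (inv_op x y)
    let ?x = "canonical thompson_quandle x" and ?y = "canonical thompson_quandle y"
    \<comment> \<open>Undoing a left multiplication in the quandle is undoing a conjugation in the group.\<close>
    have "?y = inv\<^bsub>?G\<^esub> ?x \<otimes>\<^bsub>?G\<^esub> canonical thompson_quandle (qop thompson_quandle x y) \<otimes>\<^bsub>?G\<^esub> ?x"
      using inv_op by (simp add: P.canonical_qop GrP.m_assoc) (simp flip: GrP.m_assoc)
    also have "\<dots> \<in> H"
      using inv_op H by (simp add: subgroup.m_closed subgroup.m_inv_closed)
    finally show ?case .
  qed
  have "g \<in> H"
    using g
  proof (induction rule: P.Gr_induct)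
    case one
    then show ?case using H by (rule subgroup.one_closed)
  next
    case (mult x g)
    then show ?case using H gen by (simp add: subgroup.m_closed)
  next
    case (inv_mult x g)
    then show ?case using H gen by (simp add: subgroup.m_closed subgroup.m_inv_closed)
  qed
  then show ?thesis unfolding H_def by blast
qed

section \<open>The two representations of the enveloping group\<close>

locale thompson_representations =
  fixes \<phi> :: "nat qterm set gword set \<Rightarrow> real \<Rightarrow> real"
    and \<alpha> :: "nat qterm set gword set \<Rightarrow> nat qterm set \<Rightarrow> nat qterm set"
  assumes \<phi>_hom: "\<phi> \<in> hom (Gr thompson_quandle) thompson_group"
    and \<phi>_generator [simp]: "\<phi> (canonical thompson_quandle (thompson_p j)) = thompson_x j"
    and \<alpha>_hom: "\<alpha> \<in> hom (Gr thompson_quandle) (BijGroup (carrier thompson_quandle))"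
    and \<alpha>_canonical: "q \<in> carrier thompson_quandle \<Longrightarrow>
      \<alpha> (canonical thompson_quandle q) = restrict (qop thompson_quandle q) (carrier thompson_quandle)"

lemma thompson_representations_exist: "\<exists>\<phi> \<alpha>. thompson_representations \<phi> \<alpha>"
proof -
  interpret C: quandle "Conj thompson_group"
    by (rule group.quandle_Conj[OF group_thompson_group])
  have "thompson_x j \<otimes>\<^bsub>thompson_group\<^esub> thompson_x k \<otimes>\<^bsub>thompson_group\<^esub> inv\<^bsub>thompson_group\<^esub> thompson_x j =
      thompson_x (Suc k)" if "j < k" for j k
    using F.x_commute[OF that] by (simp add: F.m_assoc)
  then have "qterm_value (Conj thompson_group) thompson_x s = qterm_value (Conj thompson_group) thompson_x t"
    if "(s, t) \<in> thompson_relations" for s t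
    using that by (auto simp: thompson_relations_def Conj_def)
  then obtain \<psi> where \<psi>: "\<psi> \<in> quandle_hom thompson_quandle (Conj thompson_group)"
    "\<And>j. \<psi> (thompson_p j) = thompson_x j"
    using C.presented_quandle_lift[of thompson_x thompson_relations]
    by (auto simp: Conj_def thompson_quandle_def thompson_p_def)
  obtain \<phi> where "\<phi> \<in> hom (Gr thompson_quandle) thompson_group"
    "\<And>q. q \<in> carrier thompson_quandle \<Longrightarrow> \<phi> (canonical thompson_quandle q) = \<psi> q"
    using P.Gr_lift[OF group_thompson_group \<psi>(1)] by blast
  moreover obtain \<alpha> where "\<alpha> \<in> hom (Gr thompson_quandle) (BijGroup (carrier thompson_quandle))"
    "\<And>q. q \<in> carrier thompson_quandle \<Longrightarrow>
      \<alpha> (canonical thompson_quandle q) = restrict (qop thompson_quandle q) (carrier thompson_quandle)"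
    using P.Gr_action by blast
  ultimately have "thompson_representations \<phi> \<alpha>"
    by (simp add: thompson_representations_def \<psi>(2))
  then show ?thesis by blast
qed

context thompson_representations
begin

sublocale \<phi>: group_hom "Gr thompson_quandle" thompson_group \<phi>
  using \<phi>_hom by (simp add: group_hom_def group_hom_axioms_def P.group_Gr group_thompson_group)

sublocale \<alpha>: group_hom "Gr thompson_quandle" "BijGroup (carrier thompson_quandle)" \<alpha>
  using \<alpha>_hom by (simp add: group_hom_def group_hom_axioms_def P.group_Gr group_BijGroup)

lemma \<phi>_word [simp]: "\<phi> (GrP.word u) = F.word u"
  by (induction u) simp_all

lemma \<phi>_eq_iff:
  assumes "g \<in> carrier (Gr thompson_quandle)" "h \<in> carrier (Gr thompson_quandle)"
  shows "\<phi> g = \<phi> h \<longleftrightarrow> g = h"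
proof
  assume eq: "\<phi> g = \<phi> h"
  let ?G = "Gr thompson_quandle"
  obtain u v where uv: "inv\<^bsub>?G\<^esub> h \<otimes>\<^bsub>?G\<^esub> g = inv\<^bsub>?G\<^esub> (GrP.word v) \<otimes>\<^bsub>?G\<^esub> GrP.word u"
    using Gr_thompson_fraction[of "inv\<^bsub>?G\<^esub> h \<otimes>\<^bsub>?G\<^esub> g"] assms by auto
  have "\<phi> (inv\<^bsub>?G\<^esub> h \<otimes>\<^bsub>?G\<^esub> g) = \<one>\<^bsub>thompson_group\<^esub>"
    using assms eq by simp
  then have "inv\<^bsub>thompson_group\<^esub> F.word v \<otimes>\<^bsub>thompson_group\<^esub> F.word u = \<one>\<^bsub>thompson_group\<^esub>"
    unfolding uv by simp
  then have "F.word u = F.word v"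
    by (rule F.inv_mult_one_imp_eq[symmetric, rotated 2]) simp_all
  then have "GrP.word u = GrP.word v"
    by (rule GrP.word_eq_if_F_word_eq)
  then have "inv\<^bsub>?G\<^esub> h \<otimes>\<^bsub>?G\<^esub> g = \<one>\<^bsub>?G\<^esub>"
    by (simp add: uv)
  then show "g = h"
    using GrP.inv_mult_one_imp_eq[OF assms(2,1)] by simp
qed simp

lemma \<phi>_iso: "\<phi> \<in> iso (Gr thompson_quandle) thompson_group"
proof -
  have "f \<in> \<phi> ` carrier (Gr thompson_quandle)" if f: "f \<in> carrier thompson_group" for f
  proof -
    have "f 1 = 1" using f by (simp add: thompson_group_carrier)
    then obtain T S where "list_all2 (maps_cell f) (cells T (0, 1)) (cells S (0, 1))"
      using subdivision_pair_exists[OF f, of 0] by auto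
    from subdivision_pair_fraction[OF f this]
    have "f = inv\<^bsub>thompson_group\<^esub> F.word (comb 0 S) \<otimes>\<^bsub>thompson_group\<^esub> F.word (comb 0 T)"
      using f F.inv_solve_left[of f "F.word (comb 0 S)" "F.word (comb 0 T)"] by simp
    also have "\<dots> = \<phi> (inv\<^bsub>Gr thompson_quandle\<^esub> GrP.word (comb 0 S) \<otimes>\<^bsub>Gr thompson_quandle\<^esub> GrP.word (comb 0 T))"
      by simp
    finally show ?thesis by (rule image_eqI) simp
  qed
  then show ?thesis
    using \<phi>.homh \<phi>_eq_iff \<phi>.hom_closed by (auto simp: iso_def bij_betw_def inj_on_def)
qed

lemma \<alpha>_closed [simp]:
  "g \<in> carrier (Gr thompson_quandle) \<Longrightarrow> q \<in> carrier thompson_quandle \<Longrightarrow> \<alpha> g q \<in> carrier thompson_quandle"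
  by (rule BijGroup_maps[OF \<alpha>.hom_closed])

lemma \<alpha>_mult [simp]:
  "g \<in> carrier (Gr thompson_quandle) \<Longrightarrow> h \<in> carrier (Gr thompson_quandle) \<Longrightarrow> q \<in> carrier thompson_quandle \<Longrightarrow>
    \<alpha> (g \<otimes>\<^bsub>Gr thompson_quandle\<^esub> h) q = \<alpha> g (\<alpha> h q)"
  by (simp add: BijGroup_apply)

lemma \<alpha>_one [simp]: "q \<in> carrier thompson_quandle \<Longrightarrow> \<alpha> \<one>\<^bsub>Gr thompson_quandle\<^esub> q = q"
  by (simp add: BijGroup_def)

text \<open>
  The values of \<open>\<alpha>\<close> at points are computed with \<open>\<alpha>_mult\<close>
  and \<open>\<alpha>_one\<close>; rewriting the unapplied products in the group of bijections
  would block these rules.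
\<close>

declare \<alpha>.hom_mult [simp del] \<alpha>.hom_one [simp del] \<alpha>.hom_inv [simp del]

lemma \<alpha>_eq_iff:
  assumes "g \<in> carrier (Gr thompson_quandle)" "h \<in> carrier (Gr thompson_quandle)"
    "q \<in> carrier thompson_quandle" "r \<in> carrier thompson_quandle"
  shows "\<alpha> g q = \<alpha> h r \<longleftrightarrow> \<alpha> (inv\<^bsub>Gr thompson_quandle\<^esub> h \<otimes>\<^bsub>Gr thompson_quandle\<^esub> g) q = r"
proof -
  have cancel: "\<alpha> h (\<alpha> (inv\<^bsub>Gr thompson_quandle\<^esub> h) s) = s" "\<alpha> (inv\<^bsub>Gr thompson_quandle\<^esub> h) (\<alpha> h s) = s"
    if "s \<in> carrier thompson_quandle" for s
    using assms that by (simp_all flip: \<alpha>_mult)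
  have "\<alpha> g q \<in> carrier thompson_quandle" using assms by simp
  then show ?thesis
    using cancel assms by (metis \<alpha>_mult GrP.inv_closed)
qed

lemma \<alpha>_generator: "j < k \<Longrightarrow> \<alpha> (canonical thompson_quandle (thompson_p j)) (thompson_p k) = thompson_p (Suc k)"
  by (simp add: \<alpha>_canonical qop_thompson_p)

lemma \<alpha>_power_fixes: "\<alpha> (GrP.word (replicate m i)) (thompson_p i) = thompson_p i"
  by (induction m) (simp_all add: \<alpha>_canonical P.idem)

text \<open>
  In the course of straightening, the last leaf is the interval from \<open>1 -
  1/2\<^sup>k\<close> to \<open>1\<close> with \<open>k = i +\<close> its depth in the
  subdivision. A rotation by \<open>x\<^sub>i\<close> happens only if the root is not a leaf, so
  \<open>i < k\<close>, and it deepens the last leaf by one level. This matches the relation of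
  the quandle by which \<open>p\<^sub>i\<close> moves \<open>p\<^sub>k\<close> to the next
  generator.
\<close>

lemma \<alpha>_comb: "\<alpha> (GrP.word (comb i T)) (thompson_p (i + right_depth T)) = thompson_p (i + carets T)"
proof (induction i T rule: comb.induct)
  case (3 i a b r)
  have "\<alpha> (GrP.word [i]) (thompson_p (i + Suc (right_depth r))) = thompson_p (i + Suc (Suc (right_depth r)))"
    using \<alpha>_generator[of i "i + Suc (right_depth r)"] by simp
  then show ?case
    using 3 by (simp add: GrP.word_append add.assoc del: GrP.word_simps)
qed simp_all

text \<open>
  Here \<open>\<phi> g\<close> is supported in the left half of the unit interval. Its two
  subdivisions have the right half as last leaf, at depth one, so both straightening words send
  \<open>p\<^sub>1\<close> to the same generator.
\<close>

lemma \<alpha>_stabilizer_1: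
  assumes g: "g \<in> carrier (Gr thompson_quandle)" and id: "\<And>t. t \<in> {1/2..1} \<Longrightarrow> \<phi> g t = t"
  shows "\<alpha> g (thompson_p 1) = thompson_p 1"
proof -
  let ?G = "Gr thompson_quandle"
  have f: "\<phi> g \<in> carrier thompson_group" using g by simp
  obtain T S where TS: "list_all2 (maps_cell (\<phi> g)) (cells T (0, 1 / 2)) (cells S (0, 1 / 2))"
    using subdivision_pair_exists[OF f, of 1] id[of "1 / 2"] by auto
  have "maps_cell (\<phi> g) (1 / 2, 1 / 2) (1 / 2, 1 / 2)"
    using id by (auto simp: maps_cell_def)
  with TS have TS': "list_all2 (maps_cell (\<phi> g)) (cells (Node T Leaf) (0, 1)) (cells (Node S Leaf) (0, 1))"
    by (simp add: list_all2_appendI)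
  have "\<phi> (GrP.word (comb 0 (Node S Leaf)) \<otimes>\<^bsub>?G\<^esub> g) = \<phi> (GrP.word (comb 0 (Node T Leaf)))"
    using subdivision_pair_fraction[OF f TS'] g by simp
  then have "GrP.word (comb 0 (Node S Leaf)) \<otimes>\<^bsub>?G\<^esub> g = GrP.word (comb 0 (Node T Leaf))"
    using g by (subst (asm) \<phi>_eq_iff) auto
  then have "\<alpha> (GrP.word (comb 0 (Node S Leaf))) (\<alpha> g (thompson_p 1)) =
      \<alpha> (GrP.word (comb 0 (Node T Leaf))) (thompson_p 1)"
    using g by (simp flip: \<alpha>_mult)
  also have "\<dots> = thompson_p (Suc (carets T))"
    using \<alpha>_comb[of 0 "Node T Leaf"] by simp
  also have "carets T = carets S"
    using list_all2_lengthD[OF TS] by (simp add: length_cells)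
  also have "thompson_p (Suc (carets S)) = \<alpha> (GrP.word (comb 0 (Node S Leaf))) (thompson_p 1)"
    using \<alpha>_comb[of 0 "Node S Leaf"] by simp
  finally show ?thesis
    using g by (simp add: \<alpha>_eq_iff)
qed

text \<open>
  Powers of \<open>g\<^sub>q\<close> for \<open>q = p\<^sub>i\<close> fix
  \<open>p\<^sub>i\<close> because the quandle is idempotent. After multiplication by them,
  \<open>g\<close> becomes an element \<open>g'\<close> that \<open>\<phi>\<close> maps to the
  identity on the support of \<open>x\<^sub>i\<close>.
\<close>

lemma \<alpha>_stabilizer:
  assumes g: "g \<in> carrier (Gr thompson_quandle)" and i: "i \<in> {0, 1}"
    and comm: "\<phi> g \<otimes>\<^bsub>thompson_group\<^esub> thompson_x i = thompson_x i \<otimes>\<^bsub>thompson_group\<^esub> \<phi> g"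
  shows "\<alpha> g (thompson_p i) = thompson_p i"
proof -
  let ?G = "Gr thompson_quandle"
  have f: "\<phi> g \<in> carrier thompson_group" using g by simp
  obtain m n where mn: "\<forall>t\<in>{1 - 1 / 2 ^ i..1}.
      (\<phi> g \<otimes>\<^bsub>thompson_group\<^esub> F.word (replicate m i)) t = F.word (replicate n i) t"
    using commuting_is_power[OF f comm] by blast
  define g' where "g' = inv\<^bsub>?G\<^esub> GrP.word (replicate n i) \<otimes>\<^bsub>?G\<^esub> (g \<otimes>\<^bsub>?G\<^esub> GrP.word (replicate m i))"
  have g': "g' \<in> carrier ?G" using g by (simp add: g'_def)
  have id: "\<phi> g' t = t" if t: "t \<in> {1 - 1 / 2 ^ i..1}" for t
  proof -
    have "(1::real) / 2 ^ i \<le> 1" by simp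
    then have t01: "t \<in> {0..1}" using t unfolding atLeastAtMost_iff by linarith
    have "\<phi> g' t = (inv\<^bsub>thompson_group\<^esub> F.word (replicate n i)) ((\<phi> g \<otimes>\<^bsub>thompson_group\<^esub> F.word (replicate m i)) t)"
      using g t01 by (simp add: g'_def thompson_group_mult_apply)
    also have "\<dots> = (inv\<^bsub>thompson_group\<^esub> F.word (replicate n i)) (F.word (replicate n i) t)"
      using mn t by simp
    also have "\<dots> = (inv\<^bsub>thompson_group\<^esub> F.word (replicate n i) \<otimes>\<^bsub>thompson_group\<^esub> F.word (replicate n i)) t"
      using t01 by (subst thompson_group_mult_apply) simp_all
    also have "\<dots> = t"
      using t01 by (simp add: thompson_group_one_apply)
    finally show ?thesis .
  qed
  have "\<alpha> g' (thompson_p i) = thompson_p i"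
  proof (cases "i = 0")
    case True
    have "\<phi> g' = \<phi> \<one>\<^bsub>?G\<^esub>"
      by (rule thompson_group_eqI) (use g' id True in \<open>simp_all add: thompson_group_one_apply\<close>)
    then have "g' = \<one>\<^bsub>?G\<^esub>"
      using g' by (subst (asm) \<phi>_eq_iff) auto
    then show ?thesis by simp
  next
    case False
    with i have "i = 1" by simp
    then show ?thesis using \<alpha>_stabilizer_1[OF g'] id by simp
  qed
  then have "\<alpha> (g \<otimes>\<^bsub>?G\<^esub> GrP.word (replicate m i)) (thompson_p i) = \<alpha> (GrP.word (replicate n i)) (thompson_p i)"
    unfolding g'_def using g by (subst \<alpha>_eq_iff) simp_all
  then show ?thesis
    using g by (simp add: \<alpha>_power_fixes)
qed

lemma orbit_representatives:
  assumes "q \<in> carrier thompson_quandle"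
  shows "\<exists>g i. g \<in> carrier (Gr thompson_quandle) \<and> i \<in> {0, 1} \<and> q = \<alpha> g (thompson_p i)"
  using assms
proof (induction rule: thompson_quandle_induct)
  let ?G = "Gr thompson_quandle"
  case (generator j)
  show ?case
  proof (induction j)
    case 0
    then show ?case by (intro exI[of _ "\<one>\<^bsub>?G\<^esub>"] exI[of _ 0]) simp
  next
    case (Suc k)
    show ?case
    proof (cases "k = 0")
      case True
      then show ?thesis by (intro exI[of _ "\<one>\<^bsub>?G\<^esub>"] exI[of _ 1]) simp
    next
      case False
      obtain g i where "g \<in> carrier ?G" "i \<in> {0, 1}" "thompson_p k = \<alpha> g (thompson_p i)"
        using Suc by blast
      with False show ?thesis
        using \<alpha>_generator[of 0 k]
        by (intro exI[of _ "canonical thompson_quandle (thompson_p 0) \<otimes>\<^bsub>?G\<^esub> g"] exI[of _ i]) simp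
    qed
  qed
next
  let ?G = "Gr thompson_quandle"
  case (op x y)
  then obtain g i where "g \<in> carrier ?G" "i \<in> {0, 1}" "y = \<alpha> g (thompson_p i)"
    by blast
  with op(1) show ?case
    by (intro exI[of _ "canonical thompson_quandle x \<otimes>\<^bsub>?G\<^esub> g"] exI[of _ i]) (simp add: \<alpha>_canonical)
next
  let ?G = "Gr thompson_quandle"
  case (inv_op x y)
  then obtain g i where g: "g \<in> carrier ?G" "i \<in> {0, 1}" "qop thompson_quandle x y = \<alpha> g (thompson_p i)"
    by blast
  then have "\<alpha> g (thompson_p i) = \<alpha> (canonical thompson_quandle x) y"
    using inv_op by (simp add: \<alpha>_canonical)
  then have "\<alpha> (inv\<^bsub>?G\<^esub> (canonical thompson_quandle x) \<otimes>\<^bsub>?G\<^esub> g) (thompson_p i) = y"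
    using inv_op g by (subst (asm) \<alpha>_eq_iff) simp_all
  with g inv_op(1) show ?case
    by (intro exI[of _ "inv\<^bsub>?G\<^esub> (canonical thompson_quandle x) \<otimes>\<^bsub>?G\<^esub> g"] exI[of _ i]) simp
qed

lemma \<phi>_conjugate_generators:
  assumes "k \<in> carrier (Gr thompson_quandle)" "i \<in> {0, 1}" "j \<in> {0, 1}"
    and "\<phi> k \<otimes>\<^bsub>thompson_group\<^esub> thompson_x i = thompson_x j \<otimes>\<^bsub>thompson_group\<^esub> \<phi> k"
  shows "i = j"
proof (rule ccontr)
  let ?F = thompson_group
  assume "i \<noteq> j"
  with assms(2,3) consider "i = 0" "j = 1" | "i = 1" "j = 0" by auto
  then show False
  proof cases
    case 1
    then show False using thompson_x_not_conjugate[of "\<phi> k"] assms by simp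
  next
    case 2
    have "inv\<^bsub>?F\<^esub> \<phi> k \<otimes>\<^bsub>?F\<^esub> thompson_x 0 =
        inv\<^bsub>?F\<^esub> \<phi> k \<otimes>\<^bsub>?F\<^esub> (thompson_x 0 \<otimes>\<^bsub>?F\<^esub> \<phi> k) \<otimes>\<^bsub>?F\<^esub> inv\<^bsub>?F\<^esub> \<phi> k"
      using assms(1) by (simp add: F.m_assoc)
    also have "\<dots> = inv\<^bsub>?F\<^esub> \<phi> k \<otimes>\<^bsub>?F\<^esub> (\<phi> k \<otimes>\<^bsub>?F\<^esub> thompson_x 1) \<otimes>\<^bsub>?F\<^esub> inv\<^bsub>?F\<^esub> \<phi> k"
      using assms(4) 2 by simp
    also have "\<dots> = thompson_x 1 \<otimes>\<^bsub>?F\<^esub> inv\<^bsub>?F\<^esub> \<phi> k"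
      using assms(1) by (simp flip: F.m_assoc)
    finally have "inv\<^bsub>?F\<^esub> \<phi> k \<otimes>\<^bsub>?F\<^esub> thompson_x 0 = thompson_x 1 \<otimes>\<^bsub>?F\<^esub> inv\<^bsub>?F\<^esub> \<phi> k" .
    then show False using thompson_x_not_conjugate[of "inv\<^bsub>?F\<^esub> \<phi> k"] assms(1) by simp
  qed
qed

lemma canonical_inj: "inj_on (canonical thompson_quandle) (carrier thompson_quandle)"
proof (rule inj_onI)
  let ?G = "Gr thompson_quandle" and ?F = thompson_group
  let ?c = "\<lambda>i. canonical thompson_quandle (thompson_p i)"
  fix q r assume "q \<in> carrier thompson_quandle" "r \<in> carrier thompson_quandle"
    and eq: "canonical thompson_quandle q = canonical thompson_quandle r"
  then obtain g i h j where g: "g \<in> carrier ?G" "i \<in> {0, 1}" "q = \<alpha> g (thompson_p i)"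
    and h: "h \<in> carrier ?G" "j \<in> {0, 1}" "r = \<alpha> h (thompson_p j)"
    using orbit_representatives by metis
  have can: "canonical thompson_quandle (\<alpha> g q) = g \<otimes>\<^bsub>?G\<^esub> canonical thompson_quandle q \<otimes>\<^bsub>?G\<^esub> inv\<^bsub>?G\<^esub> g"
    if "g \<in> carrier ?G" "q \<in> carrier thompson_quandle" for g q
    using P.canonical_action[OF \<alpha>_hom \<alpha>_canonical that] .
  define k where "k = inv\<^bsub>?G\<^esub> h \<otimes>\<^bsub>?G\<^esub> g"
  have k: "k \<in> carrier ?G" using g h by (simp add: k_def)
  have "g \<otimes>\<^bsub>?G\<^esub> ?c i \<otimes>\<^bsub>?G\<^esub> inv\<^bsub>?G\<^esub> g = h \<otimes>\<^bsub>?G\<^esub> ?c j \<otimes>\<^bsub>?G\<^esub> inv\<^bsub>?G\<^esub> h"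
    using eq g h by (simp add: can)
  then have "inv\<^bsub>?G\<^esub> h \<otimes>\<^bsub>?G\<^esub> (g \<otimes>\<^bsub>?G\<^esub> ?c i \<otimes>\<^bsub>?G\<^esub> inv\<^bsub>?G\<^esub> g) \<otimes>\<^bsub>?G\<^esub> g =
      inv\<^bsub>?G\<^esub> h \<otimes>\<^bsub>?G\<^esub> (h \<otimes>\<^bsub>?G\<^esub> ?c j \<otimes>\<^bsub>?G\<^esub> inv\<^bsub>?G\<^esub> h) \<otimes>\<^bsub>?G\<^esub> g"
    by simp
  moreover have "inv\<^bsub>?G\<^esub> h \<otimes>\<^bsub>?G\<^esub> (h \<otimes>\<^bsub>?G\<^esub> s) = s" if "s \<in> carrier ?G" for s
    using that h by (simp flip: GrP.m_assoc)
  ultimately have "k \<otimes>\<^bsub>?G\<^esub> ?c i = ?c j \<otimes>\<^bsub>?G\<^esub> k"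
    using g h by (simp add: k_def GrP.m_assoc)
  then have "\<phi> (k \<otimes>\<^bsub>?G\<^esub> ?c i) = \<phi> (?c j \<otimes>\<^bsub>?G\<^esub> k)" by simp
  then have comm: "\<phi> k \<otimes>\<^bsub>?F\<^esub> thompson_x i = thompson_x j \<otimes>\<^bsub>?F\<^esub> \<phi> k"
    using k by simp
  then have ij: "i = j"
    by (rule \<phi>_conjugate_generators[OF k g(2) h(2)])
  then have "\<alpha> k (thompson_p i) = thompson_p j"
    using \<alpha>_stabilizer[OF k g(2)] comm by simp
  then show "q = r"
    using g h by (simp add: k_def \<alpha>_eq_iff del: \<alpha>_mult)
qed

end

theorem proposition6p4:
  shows "inj_on (canonical thompson_quandle) (carrier thompson_quandle) \<and>
    (\<exists>\<phi> \<in> iso (Gr thompson_quandle) thompson_group.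
       (\<forall>j. \<phi> (canonical thompson_quandle (thompson_p j)) = thompson_x j) \<and>
       quandle_embedding thompson_quandle (Conj thompson_group) (\<phi> \<circ> canonical thompson_quandle))"
proof -
  obtain \<phi> \<alpha> where "thompson_representations \<phi> \<alpha>"
    using thompson_representations_exist by blast
  then interpret thompson_representations \<phi> \<alpha> .
  have "inj_on (\<phi> \<circ> canonical thompson_quandle) (carrier thompson_quandle)"
    using canonical_inj by (auto simp: inj_on_def \<phi>_eq_iff)
  then have "quandle_embedding thompson_quandle (Conj thompson_group) (\<phi> \<circ> canonical thompson_quandle)"
    by (auto simp: quandle_embedding_def quandle_hom_def Conj_def P.canonical_qop)
  then show ?thesis
    using canonical_inj \<phi>_iso \<phi>_generator by blast
qed

end
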